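(* Let $k$ be a field of characteristic zero, $G$ a finite subgroup of $\operatorname{GL}_n(k)$ that contains no pseudoreflections, $S:=k[x_1,\dots,x_n]$ a polynomial ring over $k$ equipped with the standard linear action of $G$, and $R:=S^G$ the ring of $G$-invariants of $S$. Then the standard transposition on $D_{S|k}$ preserves the subring $D_{R|k}$, inducing an involutive anti-automorphism on $D_{R|k}$ that fixes the subring $R$.
   Context: For a commutative $k$-algebra $R$, identify $f\in R$ with the operator $g\mapsto fg$ on $R$, so that $R\subseteq \operatorname{End}_k(R)$. Define inductively $D^0_{R|k}=R$ and $D^n_{R|k}=\{\xi\in\operatorname{End}_k(R): [\xi,f]\in D^{n-1}_{R|k}\text{ for all } f\in R\}$. The ring of $k$-linear differential operators on $R$ is $D_{R|k}=\bigcup_{n\ge 0}D^n_{R|k}\subseteq\operatorname{End}_k(R)$. A nontrivial linear transformation $\gamma\in\operatorname{GL}_n(k)$ is a pseudoreflection if there is a hyperplane $H\subseteq k^n$ on which $\gamma$ acts trivially. The standard linear action: the natural action of $G$ on $k^n$ extends to an action by algebra automorphisms on $\operatorname{Sym}_k(k^n)$, identified with $S=k[x_1,\dots,x_n]$ via the standard basis. $G$ acts on $D_{S|k}$ by $(\gamma\cdot\xi)(f)=\gamma\,\xi(\gamma^{-1}f)$ for $\gamma\in G$, $\xi\in D_{S|k}$, $f\in S$. Every $G$-invariant differential operator on $S$ restricts to a differential operator on $R$, giving a map $D_{S|k}^G\to D_{R|k}$; by a theorem of Kantor this map is an isomorphism when $G$ is finite without pseudoreflections and $\operatorname{char} k=0$,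 and $D_{R|k}$ is identified with the subring $D_{S|k}^G$ of $D_{S|k}$ via this isomorphism. In characteristic zero, $D_{S|k}$ is the Weyl algebra, generated over $k$ by $x_1,\dots,x_n$ and $\partial_i=\partial/\partial x_i$ with relations $[\partial_i,x_j]=\delta_{ij}$, $[\partial_i,\partial_j]=0$, $[x_i,x_j]=0$. The standard transposition is the (involutive) $k$-linear ring anti-automorphism of $D_{S|k}$ determined by $x_i\mapsto x_i$, $\partial_i\mapsto-\partial_i$. A ring anti-automorphism of a ring $A$ is a bijective additive map $\Phi:A\to A$ with $\Phi(1)=1$ and $\Phi(xy)=\Phi(y)\Phi(x)$; it is involutive if $\Phi\circ\Phi=\mathrm{id}$. *)

theory Defs
  imports
    "HOL-Library.Poly_Mapping"
    "HOL-Analysis.Cartesian_Space"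
    "HOL-Algebra.Ring"
begin

section \<open>Differential operators on a commutative algebra\<close>

text \<open>
  A commutative \<open>k\<close>-algebra is given by a subset \<open>R\<close> of a commutative ring type, closed under the
  ring operations and under multiplication by the image of a structure map \<open>\<iota> :: 'k \<Rightarrow> 'a\<close>.
  Endomorphisms of \<open>R\<close> are extensional functions, so that equality of
  operators on \<open>R\<close> is equality of HOL functions; for \<open>R = UNIV\<close> extensionality is no restriction.
\<close>

definition alg_End :: "('k \<Rightarrow> 'a::comm_ring_1) \<Rightarrow> 'a set \<Rightarrow> ('a \<Rightarrow> 'a) set" where
  "alg_End \<iota> R = {\<xi> \<in> R \<rightarrow>\<^sub>E R.
      (\<forall>f\<in>R. \<forall>g\<in>R. \<xi> (f + g) = \<xi> f + \<xi> g) \<and> (\<forall>c. \<forall>f\<in>R. \<xi> (\<iota> c * f) = \<iota> c * \<xi> f)}"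

definition mult_op :: "'a::comm_ring_1 set \<Rightarrow> 'a \<Rightarrow> 'a \<Rightarrow> 'a" where
  "mult_op R f = (\<lambda>g\<in>R. f * g)"

definition op_commutator :: "'a::comm_ring_1 set \<Rightarrow> ('a \<Rightarrow> 'a) \<Rightarrow> 'a \<Rightarrow> 'a \<Rightarrow> 'a" where
  "op_commutator R \<xi> f = (\<lambda>g\<in>R. \<xi> (f * g) - f * \<xi> g)"

primrec diff_ops_le :: "('k \<Rightarrow> 'a::comm_ring_1) \<Rightarrow> 'a set \<Rightarrow> nat \<Rightarrow> ('a \<Rightarrow> 'a) set" where
  "diff_ops_le \<iota> R 0 = mult_op R ` R"
| "diff_ops_le \<iota> R (Suc n) =
     {\<xi> \<in> alg_End \<iota> R. \<forall>f\<in>R. op_commutator R \<xi> f \<in> diff_ops_le \<iota> R n}"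

definition diff_op_ring :: "('k \<Rightarrow> 'a::comm_ring_1) \<Rightarrow> 'a set \<Rightarrow> ('a \<Rightarrow> 'a) ring" where
  "diff_op_ring \<iota> R =
     \<lparr>carrier = (\<Union>n. diff_ops_le \<iota> R n),
      mult = compose R,
      one = (\<lambda>g\<in>R. g),
      zero = (\<lambda>g\<in>R. 0),
      add = (\<lambda>\<xi> \<eta>. \<lambda>g\<in>R. \<xi> g + \<eta> g)\<rparr>"

definition ring_anti_automorphism :: "('a, 'm) ring_scheme \<Rightarrow> ('a \<Rightarrow> 'a) \<Rightarrow> bool" where
  "ring_anti_automorphism A \<Phi> \<longleftrightarrow>
     bij_betw \<Phi> (carrier A) (carrier A) \<and>
     (\<forall>x\<in>carrier A. \<forall>y\<in>carrier A. \<Phi> (x \<oplus>\<^bsub>A\<^esub> y) = \<Phi> x \<oplus>\<^bsub>A\<^esub> \<Phi> y) \<and>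
     \<Phi> \<one>\<^bsub>A\<^esub> = \<one>\<^bsub>A\<^esub> \<and>
     (\<forall>x\<in>carrier A. \<forall>y\<in>carrier A. \<Phi> (x \<otimes>\<^bsub>A\<^esub> y) = \<Phi> y \<otimes>\<^bsub>A\<^esub> \<Phi> x)"

definition involutive_on :: "'a set \<Rightarrow> ('a \<Rightarrow> 'a) \<Rightarrow> bool" where
  "involutive_on A \<Phi> \<longleftrightarrow> (\<forall>x\<in>A. \<Phi> (\<Phi> x) = x)"

section \<open>The polynomial ring and the standard transposition\<close>

text \<open>
  \<open>('k, 'n) mpoly\<close> is \<open>k[x\<^sub>i | i \<in> 'n]\<close> with \<open>n = CARD('n)\<close>: finitely supported coefficient
  functions on exponent vectors \<open>'n \<Rightarrow>\<^sub>0 nat\<close>, with the convolution product.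
\<close>

type_synonym ('k, 'n) mpoly = "('n \<Rightarrow>\<^sub>0 nat) \<Rightarrow>\<^sub>0 'k"

definition mconst :: "'k::field \<Rightarrow> ('k, 'n) mpoly" where
  "mconst c = Poly_Mapping.single 0 c"

definition mvar :: "'n \<Rightarrow> ('k::field, 'n) mpoly" where
  "mvar i = Poly_Mapping.single (Poly_Mapping.single i 1) 1"

text \<open>
  When \<open>x\<^sub>i\<close> does not occur in the monomial \<open>m\<close>, the truncated exponent is harmless because the
  coefficient is \<open>0\<close>.
\<close>

definition mpderiv :: "'n \<Rightarrow> ('k::field, 'n) mpoly \<Rightarrow> ('k, 'n) mpoly" where
  "mpderiv i f = (\<Sum>m\<in>Poly_Mapping.keys f.
     Poly_Mapping.single (m - Poly_Mapping.single i 1)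
       (of_nat (Poly_Mapping.lookup m i) * Poly_Mapping.lookup f m))"

abbreviation mpoly_diff_ops :: "(('k::field, 'n::finite) mpoly \<Rightarrow> ('k, 'n) mpoly) ring" where
  "mpoly_diff_ops \<equiv> diff_op_ring mconst UNIV"

definition is_standard_transposition ::
    "((('k::field, 'n::finite) mpoly \<Rightarrow> ('k, 'n) mpoly) \<Rightarrow> ('k, 'n) mpoly \<Rightarrow> ('k, 'n) mpoly) \<Rightarrow> bool"
  where
  "is_standard_transposition \<tau> \<longleftrightarrow>
     \<tau> \<in> extensional (carrier mpoly_diff_ops) \<and>
     ring_anti_automorphism mpoly_diff_ops \<tau> \<and>
     (\<forall>c. \<forall>\<xi>\<in>carrier mpoly_diff_ops. \<tau> (\<lambda>g. mconst c * \<xi> g) = (\<lambda>g. mconst c * \<tau> \<xi> g)) \<and>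
     (\<forall>i. \<tau> (mult_op UNIV (mvar i)) = mult_op UNIV (mvar i)) \<and>
     (\<forall>i. \<tau> (mpderiv i) = (\<lambda>g. - mpderiv i g))"

text \<open>In characteristic zero exactly one such map exists.\<close>

definition standard_transposition ::
    "(('k::field, 'n::finite) mpoly \<Rightarrow> ('k, 'n) mpoly) \<Rightarrow> ('k, 'n) mpoly \<Rightarrow> ('k, 'n) mpoly"
  where
  "standard_transposition = (THE \<tau>. is_standard_transposition \<tau>)"

section \<open>Linear group actions\<close>

definition GL :: "('k::field ^ 'n ^ 'n::finite) monoid" where
  "GL = \<lparr>carrier = {A. invertible A}, mult = (**), one = mat 1\<rparr>"

definition pseudoreflection :: "'k::field ^ 'n ^ 'n::finite \<Rightarrow> bool" where
  "pseudoreflection \<gamma> \<longleftrightarrow>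
     invertible \<gamma> \<and> \<gamma> \<noteq> mat 1 \<and>
     (\<exists>H. vec.subspace H \<and> vec.dim H = CARD('n) - 1 \<and> (\<forall>v\<in>H. \<gamma> *v v = v))"

text \<open>
  The variable \<open>x\<^sub>j\<close> is the \<open>j\<close>-th standard basis vector of \<open>k\<^sup>n\<close>, so \<open>\<gamma>\<close> sends it to the linear
  form whose coefficients are the \<open>j\<close>-th column of \<open>\<gamma>\<close>; this is extended to an algebra map.
\<close>

definition lin_act :: "'k::field ^ 'n ^ 'n::finite \<Rightarrow> ('k, 'n) mpoly \<Rightarrow> ('k, 'n) mpoly" where
  "lin_act \<gamma> f = (\<Sum>m\<in>Poly_Mapping.keys f.
     mconst (Poly_Mapping.lookup f m) *
       (\<Prod>j\<in>UNIV. (\<Sum>i\<in>UNIV. mconst (\<gamma> $ i $ j) * mvar i) ^ Poly_Mapping.lookup m j))"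

definition invariant_ring :: "('k::field ^ 'n ^ 'n::finite) set \<Rightarrow> ('k, 'n) mpoly set" where
  "invariant_ring G = {f. \<forall>\<gamma>\<in>G. lin_act \<gamma> f = f}"

definition op_act :: "'k::field ^ 'n ^ 'n::finite \<Rightarrow>
    (('k, 'n) mpoly \<Rightarrow> ('k, 'n) mpoly) \<Rightarrow> ('k, 'n) mpoly \<Rightarrow> ('k, 'n) mpoly" where
  "op_act \<gamma> \<xi> = (\<lambda>f. lin_act \<gamma> (\<xi> (lin_act (inv\<^bsub>GL\<^esub> \<gamma>) f)))"

definition invariant_diff_ops ::
    "('k::field ^ 'n ^ 'n::finite) set \<Rightarrow> (('k, 'n) mpoly \<Rightarrow> ('k, 'n) mpoly) set" where
  "invariant_diff_ops G = {\<xi> \<in> carrier mpoly_diff_ops. \<forall>\<gamma>\<in>G. op_act \<gamma> \<xi> = \<xi>}"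

text \<open>
  Restriction of operators from \<open>S\<close> to \<open>R = S\<^sup>G\<close>. For a finite group \<open>G\<close> without pseudoreflections
  in characteristic zero this is Kantor's isomorphism from \<open>D\<^sub>S\<^sup>G\<close> onto \<open>D\<^sub>R\<close>.
\<close>

definition restrict_op :: "('k::field ^ 'n ^ 'n::finite) set \<Rightarrow>
    (('k, 'n) mpoly \<Rightarrow> ('k, 'n) mpoly) \<Rightarrow> ('k, 'n) mpoly \<Rightarrow> ('k, 'n) mpoly" where
  "restrict_op G \<xi> = restrict \<xi> (invariant_ring G)"

text \<open>
  The map on the differential operators of \<open>R\<close> obtained from the standard transposition by transport
  along Kantor's isomorphism.
\<close>

definition induced_transposition :: "('k::field ^ 'n ^ 'n::finite) set \<Rightarrow>
    (('k, 'n) mpoly \<Rightarrow> ('k, 'n) mpoly) \<Rightarrow> ('k, 'n) mpoly \<Rightarrow> ('k, 'n) mpoly" where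
  "induced_transposition G \<delta> =
     restrict_op G (standard_transposition (the_inv_into (invariant_diff_ops G) (restrict_op G) \<delta>))"

end

(*
  Let P be the orbit polynomial of a linear form s, and D = sum over g of Q_g, where Q_g is P with
  the root g s removed; then c = D(s) is the product of the s - g s over g different from 1. The
  polynomial ring S[X] acts on End S, with X acting by left multiplication with s and constants
  acting by right multiplication. Modulo operators of lower R-order a polynomial over R acts as its
  value at s; as P(s) = 0 this makes the Q_g act as orthogonal idempotents up to the factor c, so
  they split an R-differential operator on S, up to a power of c, into summands E o g with E a
  differential operator on S. Applied to delta o trace, for delta a differential operator on R, this
  extends c^N delta to S, and the same computation gives the uniqueness of extensions. A group
  without pseudoreflections admits two linear forms whose values of c are coprime, so the
  denominators cancel: restriction is an isomorphism from the invariant operators on S to the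
  operators on R. On normal forms the transposition sends sum a_alpha d^alpha to sum (-d)^alpha
  a_alpha. By uniqueness it commutes with the group, since linear forms in the variables are fixed
  and linear forms in the derivatives change sign.
*)
theory Submission
  imports Defs "HOL-Computational_Algebra.Polynomial"
begin

section \<open>The order filtration relative to a set of multipliers\<close>

text \<open>The obstacle is that an operator \<delta> on R reaches S only as \<delta> \<circ> tr,
  which is a differential operator relative to R but in general not relative to S: a group element
  other than 1 is R-linear, yet no differential operator on S. This is why \<open>ord_less\<close>
  carries the set of multipliers as a parameter; exchanging R for S as multipliers is the real work.
  Geometrically, D is the formal derivative of P, so c = P'(s), and S is etale over R where c is
  invertible; there operators extend uniquely. Powers of c and cancellation in a domain take the
  place of localization. Absence of pseudoreflections says that S is ramified over R in codimension
  at least two only; in linear algebra, g - 1 has rank at least two for g different from 1, so a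
  second linear form can be chosen whose differences with its conjugates are proportional to none of
  those of the first. Characteristic zero serves to divide the trace by the group order, to have
  enough scalars for avoiding finitely many subspaces, and to divide by factorials in normal
  forms.\<close>

abbreviation ad :: "('a::comm_ring_1 \<Rightarrow> 'a) \<Rightarrow> 'a \<Rightarrow> 'a \<Rightarrow> 'a" where
  "ad \<equiv> op_commutator UNIV"

lemma ad_apply: "ad \<xi> f g = \<xi> (f * g) - f * \<xi> g"
  by (simp add: op_commutator_def)

lemma ad_alt: "ad \<xi> f = (\<lambda>g. \<xi> (f * g) - f * \<xi> g)"
  by (simp add: fun_eq_iff ad_apply)

lemma alg_End_UNIV_iff:
  "\<xi> \<in> alg_End \<iota> UNIV \<longleftrightarrow>
    (\<forall>f g. \<xi> (f + g) = \<xi> f + \<xi> g) \<and> (\<forall>c f. \<xi> (\<iota> c * f) = \<iota> c * \<xi> f)"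
  by (auto simp: alg_End_def)

lemma alg_End_UNIV_add: "\<xi> \<in> alg_End \<iota> UNIV \<Longrightarrow> \<xi> (f + g) = \<xi> f + \<xi> g"
  by (simp add: alg_End_UNIV_iff)

lemma alg_End_UNIV_scale: "\<xi> \<in> alg_End \<iota> UNIV \<Longrightarrow> \<xi> (\<iota> c * f) = \<iota> c * \<xi> f"
  by (simp add: alg_End_UNIV_iff)

lemma alg_End_UNIV_scale_left:
  "\<xi> \<in> alg_End \<iota> UNIV \<Longrightarrow> \<xi> (a * (\<iota> c * f)) = \<iota> c * \<xi> (a * f)"
  by (simp add: mult.left_commute[of a] alg_End_UNIV_scale)

lemma alg_End_UNIV_0: "\<xi> \<in> alg_End \<iota> UNIV \<Longrightarrow> \<xi> 0 = 0"
  using alg_End_UNIV_add[of \<xi> \<iota> 0 0] by simp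

lemma alg_End_UNIV_minus: "\<xi> \<in> alg_End \<iota> UNIV \<Longrightarrow> \<xi> (- f) = - \<xi> f"
  using alg_End_UNIV_add[of \<xi> \<iota> f "- f"] by (simp add: alg_End_UNIV_0 minus_unique)

lemma alg_End_UNIV_diff: "\<xi> \<in> alg_End \<iota> UNIV \<Longrightarrow> \<xi> (f - g) = \<xi> f - \<xi> g"
  using alg_End_UNIV_add[of \<xi> \<iota> f "- g"] by (simp add: alg_End_UNIV_minus)

lemma alg_End_UNIV_sum: "\<xi> \<in> alg_End \<iota> UNIV \<Longrightarrow> \<xi> (\<Sum>x\<in>X. h x) = (\<Sum>x\<in>X. \<xi> (h x))"
  by (induction X rule: infinite_finite_induct) (auto simp: alg_End_UNIV_add alg_End_UNIV_0)

text \<open>The index is shifted by one against \<^const>\<open>diff_ops_le\<close>, so that inductions on the order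
  start at the zero operator.\<close>

primrec ord_less :: "('k \<Rightarrow> 'a::comm_ring_1) \<Rightarrow> 'a set \<Rightarrow> nat \<Rightarrow> ('a \<Rightarrow> 'a) set" where
  "ord_less \<iota> A 0 = {\<lambda>_. 0}"
| "ord_less \<iota> A (Suc n) = {\<xi> \<in> alg_End \<iota> UNIV. \<forall>a\<in>A. ad \<xi> a \<in> ord_less \<iota> A n}"

lemma ord_less_SucI:
  "\<xi> \<in> alg_End \<iota> UNIV \<Longrightarrow> (\<And>a. a \<in> A \<Longrightarrow> ad \<xi> a \<in> ord_less \<iota> A n) \<Longrightarrow>
    \<xi> \<in> ord_less \<iota> A (Suc n)"
  by simp

lemma ord_less_SucD: "\<xi> \<in> ord_less \<iota> A (Suc n) \<Longrightarrow> a \<in> A \<Longrightarrow> ad \<xi> a \<in> ord_less \<iota> A n"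
  by simp

lemma ord_less_alg_End: "\<xi> \<in> ord_less \<iota> A n \<Longrightarrow> \<xi> \<in> alg_End \<iota> UNIV"
  by (cases n) (auto simp: alg_End_UNIV_iff)

lemma ord_less_zero: "(\<lambda>_. 0) \<in> ord_less \<iota> (A :: 'a::comm_ring_1 set) n"
proof (induction n)
  case (Suc n)
  have "ad (\<lambda>_. 0) a = (\<lambda>_. 0)" for a :: 'a by (simp add: ad_alt)
  with Suc show ?case by (auto simp: alg_End_UNIV_iff)
qed simp

lemma ord_less_Suc: "\<xi> \<in> ord_less \<iota> A n \<Longrightarrow> \<xi> \<in> ord_less \<iota> A (Suc n)"
proof (induction n arbitrary: \<xi>)
  case 0
  then show ?case using ord_less_zero[of \<iota> A "Suc 0"] by simp
next
  case (Suc n)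
  then show ?case using ord_less_alg_End[OF Suc.prems] by auto
qed

lemma ord_less_mono: "\<xi> \<in> ord_less \<iota> A m \<Longrightarrow> m \<le> n \<Longrightarrow> \<xi> \<in> ord_less \<iota> A n"
  by (induction n) (auto simp: le_Suc_eq intro: ord_less_Suc simp del: ord_less.simps)

lemma ord_less_add:
  "\<xi> \<in> ord_less \<iota> A n \<Longrightarrow> \<eta> \<in> ord_less \<iota> A n \<Longrightarrow> (\<lambda>f. \<xi> f + \<eta> f) \<in> ord_less \<iota> A n"
proof (induction n arbitrary: \<xi> \<eta>)
  case (Suc n)
  have "ad (\<lambda>f. \<xi> f + \<eta> f) a = (\<lambda>f. ad \<xi> a f + ad \<eta> a f)" for a
    by (simp add: ad_alt algebra_simps)
  with Suc show ?case by (auto simp: alg_End_UNIV_iff algebra_simps)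
qed simp

lemma ord_less_lmult: "\<xi> \<in> ord_less \<iota> A n \<Longrightarrow> (\<lambda>f. a * \<xi> f) \<in> ord_less \<iota> A n"
proof (induction n arbitrary: \<xi>)
  case (Suc n)
  have "ad (\<lambda>f. a * \<xi> f) b = (\<lambda>f. a * ad \<xi> b f)" for b
    by (simp add: ad_alt algebra_simps)
  with Suc show ?case by (auto simp: alg_End_UNIV_iff algebra_simps)
qed simp

lemma ord_less_rmult: "\<xi> \<in> ord_less \<iota> A n \<Longrightarrow> (\<lambda>f. \<xi> (a * f)) \<in> ord_less \<iota> A n"
proof (induction n arbitrary: \<xi>)
  case (Suc n)
  have "ad (\<lambda>f. \<xi> (a * f)) b = (\<lambda>f. ad \<xi> b (a * f))" for b
    by (simp add: ad_alt algebra_simps)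
  moreover have "\<xi> (a * (\<iota> c * f)) = \<iota> c * \<xi> (a * f)" for c f
    by (rule alg_End_UNIV_scale_left[OF ord_less_alg_End[OF Suc.prems]])
  ultimately show ?case using Suc by (auto simp: alg_End_UNIV_iff algebra_simps)
qed simp

lemma ord_less_uminus: "\<xi> \<in> ord_less \<iota> A n \<Longrightarrow> (\<lambda>f. - \<xi> f) \<in> ord_less \<iota> A n"
  using ord_less_lmult[of \<xi> \<iota> A n "- 1"] by simp

lemma ord_less_diff:
  "\<xi> \<in> ord_less \<iota> A n \<Longrightarrow> \<eta> \<in> ord_less \<iota> A n \<Longrightarrow> (\<lambda>f. \<xi> f - \<eta> f) \<in> ord_less \<iota> A n"
  using ord_less_add[OF _ ord_less_uminus, of \<xi> \<iota> A n \<eta>] by simp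

lemma ord_less_sum:
  "(\<And>x. x \<in> X \<Longrightarrow> \<xi> x \<in> ord_less \<iota> A n) \<Longrightarrow> (\<lambda>f. \<Sum>x\<in>X. \<xi> x f) \<in> ord_less \<iota> A n"
  by (induction X rule: infinite_finite_induct) (auto intro: ord_less_zero ord_less_add)

text \<open>The only form of division in the argument: powers of \<open>disc s\<close> are removed
  without passing to fractions. Linearity of the quotient is recovered by cancellation as well, so
  the quotient may be an arbitrary function chosen pointwise.\<close>

lemma ord_less_lmult_cancel:
  assumes nzd: "\<And>x y::'a::comm_ring_1. x * y = 0 \<Longrightarrow> x = 0 \<or> y = 0"
    and "a \<noteq> 0" and "(\<lambda>f. a * \<xi> f) \<in> ord_less \<iota> A n"
  shows "(\<xi> :: 'a \<Rightarrow> 'a) \<in> ord_less \<iota> A n"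
  using assms(3)
proof (induction n arbitrary: \<xi>)
  case 0
  then show ?case using nzd[of a] \<open>a \<noteq> 0\<close> by (auto simp: fun_eq_iff)
next
  case (Suc n)
  have cancel: "x = y" if "a * x = a * y" for x y
    using nzd[of a "x - y"] that \<open>a \<noteq> 0\<close> by (simp add: right_diff_distrib)
  note L = ord_less_alg_End[OF Suc.prems]
  have "ad (\<lambda>f. a * \<xi> f) b = (\<lambda>f. a * ad \<xi> b f)" for b
    by (simp add: ad_alt algebra_simps)
  moreover have "\<xi> (f + g) = \<xi> f + \<xi> g" for f g
    by (rule cancel[OF trans[OF alg_End_UNIV_add[OF L] distrib_left[symmetric]]])
  moreover have "\<xi> (\<iota> c * f) = \<iota> c * \<xi> f" for c f
    by (rule cancel[OF trans[OF alg_End_UNIV_scale[OF L] mult.left_commute]])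
  ultimately show ?case
    using Suc.IH Suc.prems by (simp add: alg_End_UNIV_iff)
qed

lemma mult_op_UNIV: "mult_op UNIV f = (\<lambda>g. f * g)"
  by (simp add: mult_op_def fun_eq_iff)

text \<open>The two recursions coincide, so only the base case has content: an operator whose
  commutators all vanish is multiplication by its value at 1.\<close>

lemma diff_ops_le_UNIV:
  fixes \<iota> :: "'k \<Rightarrow> 'a::comm_ring_1"
  shows "diff_ops_le \<iota> UNIV n = ord_less \<iota> UNIV (Suc n)"
proof (induction n)
  case 0
  have "\<xi> = mult_op UNIV (\<xi> 1)" if "\<forall>a. ad \<xi> a = (\<lambda>_. 0)" for \<xi> :: "'a \<Rightarrow> 'a"
  proof
    fix g show "\<xi> g = mult_op UNIV (\<xi> 1) g"
      using fun_cong[OF that[rule_format], of g 1] by (simp add: ad_apply mult_op_UNIV mult.commute)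
  qed
  moreover have "ad (mult_op UNIV f) a = (\<lambda>_. 0)" for a f :: 'a
    by (simp add: mult_op_UNIV ad_alt mult.left_commute)
  moreover have "mult_op UNIV f \<in> alg_End \<iota> UNIV" for f
    by (simp add: mult_op_UNIV alg_End_UNIV_iff distrib_left mult.left_commute)
  ultimately show ?case by auto
next
  case (Suc n)
  then show ?case by (simp only: diff_ops_le.simps ord_less.simps)
qed

lemma carrier_diff_op_ring_UNIV:
  fixes \<iota> :: "'k \<Rightarrow> 'a::comm_ring_1"
  shows "carrier (diff_op_ring \<iota> UNIV) = (\<Union>n. ord_less \<iota> UNIV n)"
proof -
  have "\<exists>m. \<xi> \<in> ord_less \<iota> UNIV (Suc m)" if "\<xi> \<in> ord_less \<iota> UNIV n" for \<xi> :: "'a \<Rightarrow> 'a" and n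
    using that ord_less_Suc by blast
  then show ?thesis
    unfolding diff_op_ring_def diff_ops_le_UNIV by (auto simp del: ord_less.simps)
qed

section \<open>Operators as a module over a polynomial ring\<close>

text \<open>The variable of \<open>S[X]\<close> acts on \<open>End S\<close> by left multiplication with \<open>s\<close>, and a constant
  \<open>a\<close> by right multiplication with \<open>a\<close>. In particular \<open>X - s\<close> acts as \<open>- ad s\<close>.\<close>

definition act :: "'a::comm_ring_1 \<Rightarrow> 'a poly \<Rightarrow> ('a \<Rightarrow> 'a) \<Rightarrow> 'a \<Rightarrow> 'a" where
  "act s Q \<xi> f = poly (map_poly (\<lambda>a. \<xi> (a * f)) Q) s"

lemma act_0 [simp]: "act s 0 \<xi> f = 0"
  by (simp add: act_def)

lemma act_pCons:
  "\<xi> \<in> alg_End \<iota> UNIV \<Longrightarrow> act s (pCons a Q) \<xi> f = \<xi> (a * f) + s * act s Q \<xi> f"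
  by (simp add: act_def map_poly_pCons alg_End_UNIV_0)

lemma act_add:
  "\<xi> \<in> alg_End \<iota> UNIV \<Longrightarrow> act s (P + Q) \<xi> f = act s P \<xi> f + act s Q \<xi> f"
proof -
  assume \<xi>: "\<xi> \<in> alg_End \<iota> UNIV"
  have "map_poly (\<lambda>a. \<xi> (a * f)) (P + Q) =
      map_poly (\<lambda>a. \<xi> (a * f)) P + map_poly (\<lambda>a. \<xi> (a * f)) Q"
    by (intro poly_eqI)
      (simp add: coeff_map_poly alg_End_UNIV_0[OF \<xi>] distrib_right alg_End_UNIV_add[OF \<xi>])
  then show ?thesis by (simp add: act_def)
qed

lemma act_sum:
  "\<xi> \<in> alg_End \<iota> UNIV \<Longrightarrow> act s (\<Sum>x\<in>X. Q x) \<xi> f = (\<Sum>x\<in>X. act s (Q x) \<xi> f)"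
  by (induction X rule: infinite_finite_induct) (auto simp: act_add)

lemma act_smult:
  assumes "\<xi> \<in> alg_End \<iota> UNIV"
  shows "act s (smult a Q) \<xi> f = act s Q \<xi> (a * f)"
  by (induction Q) (simp_all add: act_pCons[OF assms] mult.assoc mult.left_commute)

lemma act_alg_End:
  assumes "\<xi> \<in> alg_End \<iota> UNIV"
  shows "act s Q \<xi> \<in> alg_End \<iota> UNIV"
proof -
  have "act s Q \<xi> (f + g) = act s Q \<xi> f + act s Q \<xi> g" for f g
    by (induction Q) (simp_all add: act_pCons[OF assms] distrib_left alg_End_UNIV_add[OF assms])
  moreover have "act s Q \<xi> (\<iota> c * f) = \<iota> c * act s Q \<xi> f" for c f
    by (induction Q)
      (simp_all add: act_pCons[OF assms] distrib_left alg_End_UNIV_scale_left[OF assms]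
        mult.left_commute)
  ultimately show ?thesis by (simp add: alg_End_UNIV_iff)
qed

text \<open>Left multiplication by \<open>s\<close> and right multiplications commute with each
  other, so composing actions amounts to multiplying polynomials.\<close>

lemma act_mult:
  assumes "\<xi> \<in> alg_End \<iota> UNIV"
  shows "act s (P * Q) \<xi> = act s P (act s Q \<xi>)"
proof
  fix f
  show "act s (P * Q) \<xi> f = act s P (act s Q \<xi>) f"
    by (induction P)
      (simp_all add: act_add[OF assms] act_smult[OF assms] act_pCons[OF assms]
        act_pCons[OF act_alg_End[OF assms]] alg_End_UNIV_0[OF assms])
qed

lemma act_zero_op [simp]: "act s Q (\<lambda>_. 0) = (\<lambda>_. 0)"
  by (rule ext, induction Q) (auto simp: act_pCons[where \<iota> = id] alg_End_UNIV_iff)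

lemma act_add_op:
  assumes "\<xi> \<in> alg_End \<iota> UNIV" "\<eta> \<in> alg_End \<iota> UNIV"
  shows "act s Q (\<lambda>f. \<xi> f + \<eta> f) f = act s Q \<xi> f + act s Q \<eta> f"
proof -
  have "(\<lambda>f. \<xi> f + \<eta> f) \<in> alg_End \<iota> UNIV"
    using assms by (auto simp: alg_End_UNIV_iff algebra_simps)
  then show ?thesis
    by (induction Q) (simp_all add: act_pCons[where \<iota> = \<iota>] assms distrib_left)
qed

lemma act_sum_op:
  assumes "finite X" "\<And>x. x \<in> X \<Longrightarrow> \<xi> x \<in> alg_End \<iota> UNIV"
  shows "act s Q (\<lambda>f. \<Sum>x\<in>X. \<xi> x f) f = (\<Sum>x\<in>X. act s Q (\<xi> x) f)"
  using assms
proof (induction X rule: finite_induct)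
  case (insert x X)
  have "(\<lambda>f. \<Sum>x\<in>X. \<xi> x f) \<in> alg_End \<iota> UNIV"
    using insert.prems by (auto simp: alg_End_UNIV_iff sum.distrib sum_distrib_left)
  with insert show ?case by (simp add: act_add_op[where \<iota> = \<iota>])
qed simp

text \<open>Taking the commutator with \<open>f\<close> commutes with left and right
  multiplications, hence with everything built from them. This lets inductions on the order pass
  under the action.\<close>

lemma ad_act:
  assumes "\<xi> \<in> alg_End \<iota> UNIV"
  shows "ad (act s Q \<xi>) f = act s Q (ad \<xi> f)"
proof
  have "ad \<xi> f \<in> alg_End \<iota> UNIV"
    unfolding alg_End_UNIV_iff[of "ad \<xi> f"] ad_apply
    by (simp add: alg_End_UNIV_scale_left[OF assms] alg_End_UNIV_scale[OF assms]
        alg_End_UNIV_add[OF assms] distrib_left right_diff_distrib mult.left_commute[of f])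
  then show "ad (act s Q \<xi>) f g = act s Q (ad \<xi> f) g" for g
    by (induction Q)
      (simp_all add: act_pCons[where \<iota> = \<iota>] assms ad_apply algebra_simps)
qed

lemma act_ord_less:
  assumes "\<xi> \<in> ord_less \<iota> A n"
  shows "act s Q \<xi> \<in> ord_less \<iota> A n"
proof (induction Q)
  case 0
  have "act s 0 \<xi> = (\<lambda>_. 0)" by auto
  then show ?case by (simp add: ord_less_zero)
next
  case (pCons a Q)
  have "act s (pCons a Q) \<xi> = (\<lambda>f. \<xi> (a * f) + s * act s Q \<xi> f)"
    using act_pCons[OF ord_less_alg_End[OF assms]] by blast
  then show ?case using pCons assms
    by (auto intro: ord_less_add ord_less_lmult ord_less_rmult)
qed

text \<open>A coefficient acts on the right; moving it to the left costs the commutator with it,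
  which has lower order because the coefficient lies in \<open>A\<close>.\<close>

lemma act_leading:
  assumes \<xi>: "\<xi> \<in> ord_less \<iota> A (Suc n)" and "\<forall>i. coeff Q i \<in> A"
  shows "(\<lambda>f. act s Q \<xi> f - poly Q s * \<xi> f) \<in> ord_less \<iota> A n"
  using assms(2)
proof (induction Q)
  case 0
  then show ?case by (simp add: ord_less_zero)
next
  case (pCons a Q)
  have "a \<in> A" using pCons.prems[rule_format, of 0] by simp
  moreover have "\<forall>i. coeff Q i \<in> A" using pCons.prems[rule_format, of "Suc i" for i] by simp
  moreover have "(\<lambda>f. act s (pCons a Q) \<xi> f - poly (pCons a Q) s * \<xi> f) =
      (\<lambda>f. ad \<xi> a f + s * (act s Q \<xi> f - poly Q s * \<xi> f))"
    by (simp add: fun_eq_iff act_pCons[OF ord_less_alg_End[OF \<xi>]] ad_apply algebra_simps)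
  ultimately show ?case using pCons.IH \<xi>
    by (auto intro!: ord_less_add ord_less_lmult)
qed

lemma act_linear_factor:
  "\<xi> \<in> alg_End \<iota> UNIV \<Longrightarrow> act s [:- b, 1:] \<xi> f = s * \<xi> f - \<xi> (b * f)"
  by (simp add: act_pCons alg_End_UNIV_minus alg_End_UNIV_0)

lemma act_linear_factor_self:
  assumes "\<xi> \<in> ord_less \<iota> UNIV (Suc n)"
  shows "act s [:- s, 1:] \<xi> \<in> ord_less \<iota> UNIV n"
proof -
  have "act s [:- s, 1:] \<xi> = (\<lambda>f. - ad \<xi> s f)"
    by (simp add: fun_eq_iff act_linear_factor[OF ord_less_alg_End[OF assms]] ad_apply)
  then show ?thesis using assms by (auto intro!: ord_less_uminus)
qed

text \<open>Each factor takes one more commutator with \<open>s\<close>, and \<open>n\<close> of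
  them annihilate an operator in \<open>ord_less \<iota> UNIV n\<close>.\<close>

lemma act_linear_factor_power:
  assumes "\<xi> \<in> ord_less \<iota> UNIV n"
  shows "act s ([:- s, 1:] ^ n) \<xi> = (\<lambda>_. 0)"
  using assms
proof (induction n arbitrary: \<xi>)
  case 0
  then show ?case by simp
next
  case (Suc n)
  have "act s ([:- s, 1:] ^ Suc n) \<xi> = act s ([:- s, 1:] ^ n) (act s [:- s, 1:] \<xi>)"
    unfolding power_Suc2 by (rule act_mult[OF ord_less_alg_End[OF Suc.prems]])
  then show ?case using Suc.IH[OF act_linear_factor_self[OF Suc.prems]] by simp
qed

section \<open>Extending operators from the invariants of a finite group\<close>

text \<open>Inverses are replaced by injectivity: on a finite set closed under composition, left
  composition with an injective member is already a permutation, which is all that sums and products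
  over \<Gamma> require.\<close>

locale finite_aut =
  fixes \<iota> :: "'k \<Rightarrow> 'a::comm_ring_1" and \<Gamma> :: "('a \<Rightarrow> 'a) set"
  assumes nzd: "\<And>x y::'a. x * y = 0 \<Longrightarrow> x = 0 \<or> y = 0"
    and finite: "finite \<Gamma>" and id_mem: "id \<in> \<Gamma>"
    and comp_mem: "\<And>\<sigma> \<tau>. \<sigma> \<in> \<Gamma> \<Longrightarrow> \<tau> \<in> \<Gamma> \<Longrightarrow> \<sigma> \<circ> \<tau> \<in> \<Gamma>"
    and inj: "\<And>\<sigma>. \<sigma> \<in> \<Gamma> \<Longrightarrow> inj \<sigma>"
    and hom_add: "\<And>\<sigma> x y. \<sigma> \<in> \<Gamma> \<Longrightarrow> \<sigma> (x + y) = \<sigma> x + \<sigma> y"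
    and hom_mult: "\<And>\<sigma> x y. \<sigma> \<in> \<Gamma> \<Longrightarrow> \<sigma> (x * y) = \<sigma> x * \<sigma> y"
    and hom_1: "\<And>\<sigma>. \<sigma> \<in> \<Gamma> \<Longrightarrow> \<sigma> 1 = 1"
    and hom_scalar: "\<And>\<sigma> c. \<sigma> \<in> \<Gamma> \<Longrightarrow> \<sigma> (\<iota> c) = \<iota> c"
begin

definition R :: "'a set" where "R = {f. \<forall>\<sigma>\<in>\<Gamma>. \<sigma> f = f}"

definition tr :: "'a \<Rightarrow> 'a" where "tr f = (\<Sum>\<sigma>\<in>\<Gamma>. \<sigma> f)"

lemma hom_0: "\<sigma> \<in> \<Gamma> \<Longrightarrow> \<sigma> 0 = 0"
  using hom_add[of \<sigma> 0 0] by simp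

lemma hom_minus: "\<sigma> \<in> \<Gamma> \<Longrightarrow> \<sigma> (- x) = - \<sigma> x"
  using hom_add[of \<sigma> x "- x"] by (simp add: hom_0 minus_unique)

lemma hom_sum: "\<sigma> \<in> \<Gamma> \<Longrightarrow> \<sigma> (\<Sum>x\<in>X. h x) = (\<Sum>x\<in>X. \<sigma> (h x))"
  by (induction X rule: infinite_finite_induct) (auto simp: hom_add hom_0)

lemma inj_left_comp: "\<gamma> \<in> \<Gamma> \<Longrightarrow> inj_on ((\<circ>) \<gamma>) X"
  using inj by (auto simp: inj_on_def fun_eq_iff)

lemma image_left_comp: "\<gamma> \<in> \<Gamma> \<Longrightarrow> (\<circ>) \<gamma> ` \<Gamma> = \<Gamma>"
  by (rule endo_inj_surj[OF finite]) (auto simp: comp_mem inj_left_comp)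

lemma image_left_comp_diff:
  assumes "\<gamma> \<in> \<Gamma>" shows "(\<circ>) \<gamma> ` (\<Gamma> - {\<sigma>}) = \<Gamma> - {\<gamma> \<circ> \<sigma>}"
proof -
  have "(\<circ>) \<gamma> ` (\<Gamma> - {\<sigma>}) = (\<circ>) \<gamma> ` \<Gamma> - (\<circ>) \<gamma> ` {\<sigma>}"
    by (rule inj_on_image_set_diff[of _ UNIV]) (use inj_left_comp[OF assms] in auto)
  then show ?thesis by (simp add: image_left_comp[OF assms])
qed

lemma R_fixed: "r \<in> R \<Longrightarrow> \<sigma> \<in> \<Gamma> \<Longrightarrow> \<sigma> r = r"
  by (simp add: R_def)

lemma tr_mem: "tr f \<in> R"
proof -
  have "\<gamma> (tr f) = tr f" if "\<gamma> \<in> \<Gamma>" for \<gamma>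
  proof -
    have "tr f = (\<Sum>\<sigma>\<in>(\<circ>) \<gamma> ` \<Gamma>. \<sigma> f)" by (simp add: tr_def image_left_comp that)
    also have "\<dots> = (\<Sum>\<sigma>\<in>\<Gamma>. \<gamma> (\<sigma> f))"
      by (subst sum.reindex[OF inj_left_comp[OF that]]) simp
    also have "\<dots> = \<gamma> (tr f)" by (simp add: tr_def hom_sum that)
    finally show ?thesis by simp
  qed
  then show ?thesis by (simp add: R_def)
qed

lemma tr_R: "r \<in> R \<Longrightarrow> tr (r * f) = r * tr f"
  by (auto simp: tr_def hom_mult sum_distrib_left R_fixed intro!: sum.cong)

lemma tr_of_R: "r \<in> R \<Longrightarrow> tr r = of_nat (card \<Gamma>) * r"
  using sum.cong[of \<Gamma> \<Gamma> "\<lambda>\<sigma>. \<sigma> r" "\<lambda>_. r"] by (simp add: tr_def R_fixed)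

lemma scalar_mem: "\<iota> c \<in> R"
  by (simp add: R_def hom_scalar)

lemma R_mult: "a \<in> R \<Longrightarrow> b \<in> R \<Longrightarrow> a * b \<in> R"
  unfolding R_def mem_Collect_eq by (intro ballI) (metis hom_mult)

lemma R_add: "a \<in> R \<Longrightarrow> b \<in> R \<Longrightarrow> a + b \<in> R"
  by (auto simp: R_def hom_add)

text \<open>\<gamma> is R-linear, so commutators with elements of R pass through it. With
  \<open>UNIV\<close> in place of R this breaks down as soon as \<gamma> moves something.\<close>

lemma comp_ord_less:
  assumes "\<gamma> \<in> \<Gamma>" "\<xi> \<in> ord_less \<iota> R n" shows "\<xi> \<circ> \<gamma> \<in> ord_less \<iota> R n"
  using assms(2)
proof (induction n arbitrary: \<xi>)
  case 0
  then show ?case by (simp add: fun_eq_iff)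
next
  case (Suc n)
  have "ad (\<xi> \<circ> \<gamma>) r = ad \<xi> r \<circ> \<gamma>" if "r \<in> R" for r
    using R_fixed[OF that assms(1)] assms(1) by (simp add: fun_eq_iff ad_apply hom_mult)
  moreover have "\<xi> \<circ> \<gamma> \<in> alg_End \<iota> UNIV"
    using Suc.prems assms(1) by (simp add: alg_End_UNIV_iff hom_add hom_mult hom_scalar)
  ultimately show ?case
    using Suc.IH[OF ord_less_SucD[OF Suc.prems]] by (intro ord_less_SucI) (simp_all only:)
qed

text \<open>\<open>tr\<close> is R-linear with values in R, so the commutators of \<delta> \<circ>
  tr with R are those of \<delta>, again composed with \<open>tr\<close>.\<close>

lemma tr_ord_less:
  "\<delta> \<in> diff_ops_le \<iota> R n \<Longrightarrow> \<delta> \<circ> tr \<in> ord_less \<iota> R (Suc n)"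
proof (induction n arbitrary: \<delta>)
  case 0
  then obtain f where f: "f \<in> R" "\<delta> = mult_op R f" by auto
  then have "\<delta> \<circ> tr = (\<lambda>g. f * tr g)" by (auto simp: mult_op_def tr_mem)
  moreover have "tr (f + g) = tr f + tr g" for f g by (simp add: tr_def hom_add sum.distrib)
  ultimately show ?case
    by (simp add: alg_End_UNIV_iff tr_R scalar_mem ad_alt distrib_left mult.left_commute)
next
  case (Suc n)
  have "tr (f + g) = tr f + tr g" for f g by (simp add: tr_def hom_add sum.distrib)
  then have "\<delta> \<circ> tr \<in> alg_End \<iota> UNIV"
    using Suc.prems tr_mem by (auto simp: alg_End_UNIV_iff tr_R scalar_mem alg_End_def)
  moreover have "ad (\<delta> \<circ> tr) r = op_commutator R \<delta> r \<circ> tr" if "r \<in> R" for r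
    using that by (simp add: fun_eq_iff ad_apply op_commutator_def tr_mem tr_R)
  ultimately show ?case
    using Suc.prems Suc.IH[of "op_commutator R \<delta> r" for r]
    by (intro ord_less_SucI[where n = "Suc n"])
      (simp_all only: diff_ops_le.simps mem_Collect_eq)
qed

section \<open>Orbit polynomials and their factors\<close>

definition lin :: "'a \<Rightarrow> ('a \<Rightarrow> 'a) \<Rightarrow> 'a poly" where
  "lin s \<sigma> = [:- \<sigma> s, 1:]"

definition Q :: "'a \<Rightarrow> ('a \<Rightarrow> 'a) \<Rightarrow> 'a poly" where
  "Q s \<gamma> = (\<Prod>\<sigma>\<in>\<Gamma>-{\<gamma>}. lin s \<sigma>)"

definition disc :: "'a \<Rightarrow> 'a" where
  "disc s = (\<Prod>\<sigma>\<in>\<Gamma>-{id}. s - \<sigma> s)"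

abbreviation P :: "'a \<Rightarrow> 'a poly" where
  "P s \<equiv> (\<Prod>\<sigma>\<in>\<Gamma>. lin s \<sigma>)"

lemma map_poly_mult: "\<gamma> \<in> \<Gamma> \<Longrightarrow> map_poly \<gamma> (p * q) = map_poly \<gamma> p * map_poly \<gamma> q"
  by (intro poly_eqI) (simp add: coeff_map_poly hom_0 coeff_mult hom_sum hom_mult)

lemma map_poly_sum: "\<gamma> \<in> \<Gamma> \<Longrightarrow> map_poly \<gamma> (\<Sum>x\<in>X. p x) = (\<Sum>x\<in>X. map_poly \<gamma> (p x))"
  by (intro poly_eqI) (simp add: coeff_map_poly hom_0 coeff_sum hom_sum)

lemma map_poly_prod: "\<gamma> \<in> \<Gamma> \<Longrightarrow> map_poly \<gamma> (\<Prod>x\<in>X. p x) = (\<Prod>x\<in>X. map_poly \<gamma> (p x))"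
  by (induction X rule: infinite_finite_induct) (auto simp: map_poly_mult hom_1)

lemma map_poly_lin: "\<gamma> \<in> \<Gamma> \<Longrightarrow> map_poly \<gamma> (lin s \<sigma>) = lin s (\<gamma> \<circ> \<sigma>)"
  by (simp add: lin_def map_poly_pCons hom_0 hom_1 hom_minus)

lemma prod_lin_comp:
  "\<gamma> \<in> \<Gamma> \<Longrightarrow> (\<Prod>\<sigma>\<in>X. lin s (\<gamma> \<circ> \<sigma>)) = (\<Prod>\<sigma>\<in>(\<circ>) \<gamma> ` X. lin s \<sigma>)"
  by (subst prod.reindex[OF inj_left_comp]) auto

lemma map_poly_Q: "\<gamma> \<in> \<Gamma> \<Longrightarrow> map_poly \<gamma> (Q s \<sigma>) = Q s (\<gamma> \<circ> \<sigma>)"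
  by (simp add: Q_def map_poly_prod map_poly_lin prod_lin_comp image_left_comp_diff)

lemma map_poly_P: "\<gamma> \<in> \<Gamma> \<Longrightarrow> map_poly \<gamma> (P s) = P s"
  by (simp add: map_poly_prod map_poly_lin prod_lin_comp image_left_comp)

lemma coeff_R_iff: "(\<forall>i. coeff p i \<in> R) \<longleftrightarrow> (\<forall>\<gamma>\<in>\<Gamma>. map_poly \<gamma> p = p)"
  by (auto simp: R_def poly_eq_iff coeff_map_poly hom_0)

lemma coeff_P: "coeff (P s) i \<in> R"
  using coeff_R_iff map_poly_P by blast

lemma sum_left_comp: "\<gamma> \<in> \<Gamma> \<Longrightarrow> (\<Sum>\<sigma>\<in>\<Gamma>. h (\<gamma> \<circ> \<sigma>)) = (\<Sum>\<sigma>\<in>\<Gamma>. h \<sigma>)"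
  using sum.reindex[OF inj_left_comp, where A = \<Gamma> and g = h] by (simp add: image_left_comp)

lemma map_poly_sum_Q: "\<gamma> \<in> \<Gamma> \<Longrightarrow> map_poly \<gamma> (\<Sum>\<sigma>\<in>\<Gamma>. Q s \<sigma>) = (\<Sum>\<sigma>\<in>\<Gamma>. Q s \<sigma>)"
  by (simp add: map_poly_sum map_poly_Q sum_left_comp)

lemma coeff_sum_Q_power: "coeff ((\<Sum>\<sigma>\<in>\<Gamma>. Q s \<sigma>) ^ n) i \<in> R"
proof -
  have "map_poly \<gamma> ((\<Sum>\<sigma>\<in>\<Gamma>. Q s \<sigma>) ^ n) = (\<Sum>\<sigma>\<in>\<Gamma>. Q s \<sigma>) ^ n" if "\<gamma> \<in> \<Gamma>" for \<gamma>
    by (induction n) (simp_all add: map_poly_mult map_poly_sum_Q that hom_1)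
  then show ?thesis using coeff_R_iff by blast
qed

lemma P_split: "\<gamma> \<in> \<Gamma> \<Longrightarrow> P s = lin s \<gamma> * Q s \<gamma>"
  unfolding Q_def by (rule prod.remove[OF finite])

lemma poly_Q_id: "poly (Q s id) s = disc s"
  by (simp add: Q_def disc_def poly_prod lin_def)

lemma Q_split: "\<gamma> \<noteq> id \<Longrightarrow> Q s \<gamma> = [:- s, 1:] * (\<Prod>\<sigma>\<in>\<Gamma>-{\<gamma>}-{id}. lin s \<sigma>)"
  unfolding Q_def by (subst prod.remove[of _ id]) (auto simp: id_mem finite lin_def)

lemma poly_Q: "\<gamma> \<noteq> id \<Longrightarrow> poly (Q s \<gamma>) s = 0"
  by (simp add: Q_split)

lemma poly_sum_Q: "poly (\<Sum>\<sigma>\<in>\<Gamma>. Q s \<sigma>) s = disc s"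
proof -
  have "poly (\<Sum>\<sigma>\<in>\<Gamma>. Q s \<sigma>) s = (\<Sum>\<sigma>\<in>\<Gamma>. if \<sigma> = id then disc s else 0)"
    unfolding poly_sum by (intro sum.cong) (auto simp: poly_Q poly_Q_id)
  then show ?thesis by (simp add: finite id_mem)
qed

text \<open>\<open>Q s \<gamma>\<close> lacks only the factor belonging to \<gamma>, and
  \<open>Q s \<sigma>\<close> supplies it since \<sigma> differs from \<gamma>.\<close>

lemma P_dvd_Q_mult:
  assumes "\<gamma> \<in> \<Gamma>" "\<sigma> \<in> \<Gamma>" "\<gamma> \<noteq> \<sigma>" shows "P s dvd Q s \<gamma> * Q s \<sigma>"
proof -
  have "lin s \<gamma> dvd Q s \<sigma>" unfolding Q_def using assms finite by (intro dvd_prodI) auto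
  then show ?thesis
    unfolding P_split[OF assms(1)] mult.commute[of "lin s \<gamma>"] by (intro mult_dvd_mono) simp
qed

text \<open>The \<open>Q s \<gamma>\<close> are orthogonal modulo \<open>P s\<close>.\<close>

lemma P_dvd_sum_Q_power:
  "P s dvd (\<Sum>\<sigma>\<in>\<Gamma>. Q s \<sigma> ^ Suc n) - (\<Sum>\<sigma>\<in>\<Gamma>. Q s \<sigma>) ^ Suc n"
proof (induction n)
  case (Suc n)
  let ?D = "\<Sum>\<sigma>\<in>\<Gamma>. Q s \<sigma>"
  \<comment> \<open>Exchanging one factor \<open>Q s \<gamma>\<close> for the whole sum only adds
    products of two different \<open>Q\<close>, which \<open>P s\<close> divides.\<close>
  have "P s dvd Q s \<gamma> ^ Suc (Suc n) - Q s \<gamma> ^ Suc n * ?D" if "\<gamma> \<in> \<Gamma>" for \<gamma>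
  proof -
    have "?D = Q s \<gamma> + (\<Sum>\<sigma>\<in>\<Gamma>-{\<gamma>}. Q s \<sigma>)" by (rule sum.remove[OF finite that])
    then have "Q s \<gamma> ^ Suc (Suc n) - Q s \<gamma> ^ Suc n * ?D =
        - (Q s \<gamma> ^ n * (\<Sum>\<sigma>\<in>\<Gamma>-{\<gamma>}. Q s \<gamma> * Q s \<sigma>))"
      by (simp add: algebra_simps sum_distrib_left)
    also have "P s dvd \<dots>"
      unfolding dvd_minus_iff using that by (intro dvd_mult dvd_sum P_dvd_Q_mult) auto
    finally show ?thesis .
  qed
  then have "P s dvd (\<Sum>\<gamma>\<in>\<Gamma>. Q s \<gamma> ^ Suc (Suc n) - Q s \<gamma> ^ Suc n * ?D)" by (rule dvd_sum)
  moreover have "P s dvd ((\<Sum>\<sigma>\<in>\<Gamma>. Q s \<sigma> ^ Suc n) - ?D ^ Suc n) * ?D" using Suc by (rule dvd_mult2)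
  ultimately have "P s dvd (\<Sum>\<gamma>\<in>\<Gamma>. Q s \<gamma> ^ Suc (Suc n) - Q s \<gamma> ^ Suc n * ?D)
      + ((\<Sum>\<sigma>\<in>\<Gamma>. Q s \<sigma> ^ Suc n) - ?D ^ Suc n) * ?D" by (rule dvd_add)
  also have "\<dots> = (\<Sum>\<sigma>\<in>\<Gamma>. Q s \<sigma> ^ Suc (Suc n)) - ?D ^ Suc (Suc n)"
    by (simp add: sum_subtractf sum_distrib_right left_diff_distrib power_Suc2 mult.assoc
        del: power_Suc)
  finally show ?case .
qed simp

section \<open>From commutators with R to commutators with S\<close>

lemma act_P:
  assumes "\<xi> \<in> ord_less \<iota> R (Suc n)" and "P s dvd p"
  shows "act s p \<xi> \<in> ord_less \<iota> R n"
proof -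
  \<comment> \<open>The cofactor acts first. Its coefficients need not lie in R, but every action
    preserves the order; the drop comes from \<open>P s\<close>, which has coefficients in R and the
    root \<open>s\<close>.\<close>
  obtain q where q: "p = P s * q" using assms(2) by (elim dvdE)
  have "P s = [:- s, 1:] * Q s id" using P_split[OF id_mem] by (simp add: lin_def)
  then have "poly (P s) s = 0" by simp
  have "act s q \<xi> \<in> ord_less \<iota> R (Suc n)" using assms(1) by (rule act_ord_less)
  then have "act s (P s) (act s q \<xi>) \<in> ord_less \<iota> R n"
    using act_leading[of "act s q \<xi>" \<iota> R n "P s" s] coeff_P \<open>poly (P s) s = 0\<close> by simp
  then show ?thesis unfolding q act_mult[OF ord_less_alg_End[OF assms(1)]] .
qed

text \<open>Commutators obey a product rule in the multiplier, so a bound for \<open>s\<close> and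
  for R spreads to the subring R[s].\<close>

lemma ad_poly_ord_less:
  assumes "ad \<xi> s \<in> ord_less \<iota> R n" "\<And>r. r \<in> R \<Longrightarrow> ad \<xi> r \<in> ord_less \<iota> R n"
    and \<xi>: "\<xi> \<in> alg_End \<iota> UNIV" and "\<forall>i. coeff p i \<in> R"
  shows "ad \<xi> (poly p s) \<in> ord_less \<iota> R n"
  using assms(4)
proof (induction p)
  case 0
  have "ad \<xi> (poly 0 s) = (\<lambda>_. 0)" by (simp add: ad_alt alg_End_UNIV_0[OF \<xi>])
  then show ?case by (simp add: ord_less_zero)
next
  case (pCons a p)
  have "a \<in> R" using pCons.prems[rule_format, of 0] by simp
  moreover have "\<forall>i. coeff p i \<in> R" using pCons.prems[rule_format, of "Suc i" for i] by simp
  moreover have "ad \<xi> (poly (pCons a p) s) =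
      (\<lambda>f. ad \<xi> a f + (ad \<xi> s (poly p s * f) + s * ad \<xi> (poly p s) f))"
    by (simp add: fun_eq_iff ad_apply alg_End_UNIV_add[OF \<xi>] algebra_simps)
  ultimately show ?case using pCons.IH assms(1,2)
    by (auto intro!: ord_less_add ord_less_lmult ord_less_rmult)
qed

text \<open>Lagrange interpolation without denominators: the sum of the
  \<open>smult (\<sigma> f) (Q s \<sigma>)\<close> is permuted by \<Gamma>, hence has coefficients
  in R, and at \<open>s\<close> only the term for \<open>id\<close> survives. So
  \<open>disc s\<close> multiplies S into R[s].\<close>

lemma disc_mult_eq_poly: "\<exists>p. (\<forall>i. coeff p i \<in> R) \<and> disc s * f = poly p s"
proof -
  let ?p = "\<Sum>\<sigma>\<in>\<Gamma>. map_poly \<sigma> (smult f (Q s id))"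
  have "map_poly \<gamma> ?p = ?p" if "\<gamma> \<in> \<Gamma>" for \<gamma>
  proof -
    have "map_poly \<gamma> ?p = (\<Sum>\<sigma>\<in>\<Gamma>. map_poly (\<gamma> \<circ> \<sigma>) (smult f (Q s id)))"
      by (simp add: map_poly_sum that map_poly_map_poly hom_0)
    then show ?thesis by (simp add: sum_left_comp[OF that, of "\<lambda>\<sigma>. map_poly \<sigma> (smult f (Q s id))"])
  qed
  then have "\<forall>i. coeff ?p i \<in> R" using coeff_R_iff by blast
  moreover have "poly ?p s = disc s * f"
  proof -
    have "poly ?p s = (\<Sum>\<sigma>\<in>\<Gamma>. if \<sigma> = id then disc s * f else 0)"
      unfolding poly_sum
      by (intro sum.cong)
        (auto simp: map_poly_smult hom_0 hom_mult map_poly_Q poly_Q poly_Q_id mult.commute)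
    then show ?thesis by (simp add: finite id_mem)
  qed
  ultimately show ?thesis by metis
qed

text \<open>After acting with \<open>Q s id\<close>, the commutator with \<open>s\<close> is, up to
  sign, the action of \<open>P s\<close> and so of lower order. The commutators with R are lower
  anyway, hence so are those with R[s], which contains \<open>disc s * f\<close> for every
  \<open>f\<close>; finally \<open>disc s\<close> is cancelled.\<close>

lemma ad_act_Q:
  assumes "disc s \<noteq> 0" and \<xi>: "\<xi> \<in> ord_less \<iota> R (Suc n)"
  shows "ad (act s (Q s id) \<xi>) f \<in> ord_less \<iota> R n"
proof -
  let ?\<Psi> = "act s (Q s id) \<xi>"
  note \<xi>' = ord_less_alg_End[OF \<xi>]
  have \<Psi>: "?\<Psi> \<in> ord_less \<iota> R (Suc n)" using \<xi> by (rule act_ord_less)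
  have "act s (P s) \<xi> = act s [:- s, 1:] ?\<Psi>"
    using act_mult[OF \<xi>', of s "[:- s, 1:]" "Q s id"] P_split[OF id_mem] by (simp add: lin_def)
  also have "\<dots> = (\<lambda>f. - ad ?\<Psi> s f)"
    by (simp add: fun_eq_iff act_linear_factor[OF ord_less_alg_End[OF \<Psi>]] ad_apply)
  finally have "ad ?\<Psi> s = (\<lambda>f. - act s (P s) \<xi> f)" by (simp add: fun_eq_iff)
  then have s: "ad ?\<Psi> s \<in> ord_less \<iota> R n" using act_P[OF \<xi>, of s "P s"] ord_less_uminus by auto
  have r: "ad ?\<Psi> r \<in> ord_less \<iota> R n" if "r \<in> R" for r using \<Psi> that by auto
  have poly: "ad ?\<Psi> (disc s * f) \<in> ord_less \<iota> R n" for f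
    using disc_mult_eq_poly[of s f] ad_poly_ord_less[OF s r ord_less_alg_End[OF \<Psi>]] by metis
  \<comment> \<open>Both commutators on the right are with elements of R[s]; the factor 1 only
    brings \<open>disc s\<close> into the form covered by \<open>poly\<close>.\<close>
  have "(\<lambda>g. disc s * ad ?\<Psi> f g) = (\<lambda>g. ad ?\<Psi> (disc s * f) g - ad ?\<Psi> (disc s * 1) (f * g))"
    by (simp add: fun_eq_iff ad_apply algebra_simps)
  also have "\<dots> \<in> ord_less \<iota> R n"
    by (intro ord_less_diff poly ord_less_rmult[of "ad ?\<Psi> (disc s * 1)"])
  finally show ?thesis using nzd assms(1) by (rule ord_less_lmult_cancel[rotated 2])
qed

text \<open>One application of \<open>Q s id\<close> makes the commutators with all of S lower the
  R-order. As the action commutes with \<open>ad\<close>, \<open>n\<close> applications use up an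
  R-order below \<open>n\<close> and leave an operator of S-order below \<open>n\<close>.\<close>

lemma act_Q_power_diff_op:
  assumes "disc s \<noteq> 0" and "\<xi> \<in> ord_less \<iota> R n"
  shows "act s (Q s id ^ n) \<xi> \<in> ord_less \<iota> UNIV n"
  using assms(2)
proof (induction n arbitrary: \<xi>)
  case 0
  then show ?case by (simp add: fun_eq_iff)
next
  case (Suc n)
  note \<xi> = ord_less_alg_End[OF Suc.prems]
  let ?\<Psi> = "act s (Q s id) \<xi>"
  have "ad (act s (Q s id ^ n) ?\<Psi>) f \<in> ord_less \<iota> UNIV n" for f
    unfolding ad_act[OF act_alg_End[OF \<xi>]] by (intro Suc.IH ad_act_Q assms(1) Suc.prems)
  then show ?case
    unfolding power_Suc2 act_mult[OF \<xi>] by (simp add: act_alg_End \<xi>)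
qed

text \<open>Moving \<gamma> past right multiplications applies it to the coefficients, while
  \<open>s\<close>, which multiplies on the left, is untouched. This turns \<open>Q s id\<close>
  into \<open>Q s \<gamma>\<close>.\<close>

lemma act_comp:
  assumes "\<gamma> \<in> \<Gamma>" and \<xi>: "\<xi> \<in> alg_End \<iota> UNIV"
  shows "act s p (\<xi> \<circ> \<gamma>) = act s (map_poly \<gamma> p) \<xi> \<circ> \<gamma>"
proof
  have "\<xi> \<circ> \<gamma> \<in> alg_End \<iota> UNIV"
    using \<xi> assms(1) by (auto simp: alg_End_UNIV_iff hom_add hom_mult hom_scalar)
  then show "act s p (\<xi> \<circ> \<gamma>) f = (act s (map_poly \<gamma> p) \<xi> \<circ> \<gamma>) f" for f
    by (induction p)
      (simp_all add: act_pCons[where \<iota> = \<iota>] \<xi> map_poly_pCons hom_0 hom_mult assms(1))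
qed

lemma map_poly_Q_power: "\<gamma> \<in> \<Gamma> \<Longrightarrow> map_poly \<gamma> (Q s id ^ n) = Q s \<gamma> ^ n"
  by (induction n) (simp_all add: map_poly_mult map_poly_Q hom_1)

text \<open>Each summand of \<open>\<eta>0\<close> is a differential operator on S, and on R their
  sum is the action of a polynomial congruent to a power of D modulo \<open>P s\<close>. To leading
  order this is multiplication of \<xi> by a power of \<open>disc s\<close>; the error has lower
  R-order and is extended by induction, at the price of a further power.\<close>

lemma extend_with_denominator:
  assumes "disc s \<noteq> 0" and "\<xi> \<in> ord_less \<iota> R n"
  shows "\<exists>N. \<exists>\<eta>\<in>ord_less \<iota> UNIV n. \<forall>r\<in>R. \<eta> r = disc s ^ N * \<xi> r"
  using assms(2)
proof (induction n arbitrary: \<xi>)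
  case 0
  then show ?case by auto
next
  case (Suc n)
  note \<xi> = ord_less_alg_End[OF Suc.prems]
  let ?p = "\<Sum>\<gamma>\<in>\<Gamma>. Q s \<gamma> ^ Suc n" and ?D = "\<Sum>\<gamma>\<in>\<Gamma>. Q s \<gamma>"
  define \<eta>0 where "\<eta>0 = (\<lambda>f. \<Sum>\<gamma>\<in>\<Gamma>. act s (Q s id ^ Suc n) (\<xi> \<circ> \<gamma>) f)"
  have \<eta>0: "\<eta>0 \<in> ord_less \<iota> UNIV (Suc n)"
    unfolding \<eta>0_def
    by (intro ord_less_sum act_Q_power_diff_op assms(1) comp_ord_less Suc.prems)
  \<comment> \<open>On R the inner \<gamma> is invisible; only its effect on the coefficients of
    \<open>Q s id\<close> remains.\<close>
  have \<eta>0_R: "\<eta>0 r = act s ?p \<xi> r" if "r \<in> R" for r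
    unfolding \<eta>0_def act_sum[OF \<xi>]
    using that
    by (intro sum.cong) (simp_all add: act_comp[OF _ \<xi>] map_poly_Q_power R_fixed del: power_Suc)
  define \<xi>' where "\<xi>' = (\<lambda>f. act s ?p \<xi> f - disc s ^ Suc n * \<xi> f)"
  \<comment> \<open>The first summand is the action of a multiple of \<open>P s\<close>, the second
    the leading-term error of a polynomial over R; both have lower R-order.\<close>
  have "\<xi>' = (\<lambda>f. act s (?p - ?D ^ Suc n) \<xi> f
      + (act s (?D ^ Suc n) \<xi> f - poly (?D ^ Suc n) s * \<xi> f))"
    using act_add[OF \<xi>, of s "?p - ?D ^ Suc n" "?D ^ Suc n"]
    by (simp add: \<xi>'_def fun_eq_iff poly_power poly_sum_Q del: power_Suc)
  also have "\<dots> \<in> ord_less \<iota> R n"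
    by (intro ord_less_add act_P act_leading Suc.prems P_dvd_sum_Q_power allI coeff_sum_Q_power)
  finally obtain N \<eta>' where \<eta>': "\<eta>' \<in> ord_less \<iota> UNIV n" "\<forall>r\<in>R. \<eta>' r = disc s ^ N * \<xi>' r"
    using Suc.IH by metis
  let ?\<eta> = "\<lambda>f. disc s ^ N * \<eta>0 f - \<eta>' f"
  have "?\<eta> \<in> ord_less \<iota> UNIV (Suc n)"
    by (intro ord_less_diff ord_less_lmult \<eta>0 ord_less_Suc \<eta>')
  moreover have "\<forall>r\<in>R. ?\<eta> r = disc s ^ (N + Suc n) * \<xi> r"
    using \<eta>'(2)
    by (simp add: \<eta>0_R \<xi>'_def power_add right_diff_distrib mult.assoc del: power_Suc add_Suc_right)
  ultimately show ?case by (intro exI bexI[of _ ?\<eta>])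
qed

text \<open>Since \<xi> \<circ> tr = 0, the operators \<xi> \<circ> \<gamma> sum to zero. A high
  power of \<open>Q s id\<close> acts on the terms with \<gamma> different from \<open>id\<close>
  through \<open>Q s \<gamma>\<close>, which contains X - s and so annihilates \<xi>. What is left
  says that this power kills \<xi> itself, and comparing leading terms lowers the order.\<close>

lemma diff_op_eq_zero:
  assumes "disc s \<noteq> 0" and "\<xi> \<in> ord_less \<iota> UNIV n" and "\<forall>r\<in>R. \<xi> r = 0"
  shows "\<xi> = (\<lambda>_. 0)"
  using assms(2,3)
proof (induction n arbitrary: \<xi>)
  case 0
  then show ?case by simp
next
  case (Suc n)
  note \<xi> = ord_less_alg_End[OF Suc.prems(1)]
  let ?q = "Q s id ^ Suc n"
  have comp: "\<xi> \<circ> \<gamma> \<in> alg_End \<iota> UNIV" if "\<gamma> \<in> \<Gamma>" for \<gamma>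
    using \<xi> that by (auto simp: alg_End_UNIV_iff hom_add hom_mult hom_scalar)
  have "act s ?q \<xi> f = 0" for f
  proof -
    have kill: "act s ?q (\<xi> \<circ> \<gamma>) f = 0" if "\<gamma> \<in> \<Gamma>" "\<gamma> \<noteq> id" for \<gamma>
    proof -
      define p where "p = (\<Prod>\<sigma>\<in>\<Gamma>-{\<gamma>}-{id}. lin s \<sigma>)"
      have "act s ?q (\<xi> \<circ> \<gamma>) = act s (p ^ Suc n * [:- s, 1:] ^ Suc n) \<xi> \<circ> \<gamma>"
        unfolding act_comp[OF that(1) \<xi>] map_poly_Q_power[OF that(1)] Q_split[OF that(2)] p_def
          power_mult_distrib mult.commute[of "[:- s, 1:] ^ Suc n"] ..
      also have "act s (p ^ Suc n * [:- s, 1:] ^ Suc n) \<xi> = (\<lambda>_. 0)"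
        unfolding act_mult[OF \<xi>] act_linear_factor_power[OF Suc.prems(1)] by simp
      finally show ?thesis by (rule fun_cong[THEN trans]) simp
    qed
    have "(\<Sum>\<gamma>\<in>\<Gamma>. (\<xi> \<circ> \<gamma>) g) = 0" for g
      using alg_End_UNIV_sum[OF \<xi>, of "\<lambda>\<gamma>. \<gamma> g" \<Gamma>] Suc.prems(2) tr_mem[of g]
      by (simp add: tr_def)
    then have "0 = act s ?q (\<lambda>g. \<Sum>\<gamma>\<in>\<Gamma>. (\<xi> \<circ> \<gamma>) g) f" by simp
    also have "\<dots> = (\<Sum>\<gamma>\<in>\<Gamma>. act s ?q (\<xi> \<circ> \<gamma>) f)"
      by (rule act_sum_op[OF finite comp])
    also have "\<dots> = (\<Sum>\<gamma>\<in>\<Gamma>. if \<gamma> = id then act s ?q \<xi> f else 0)"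
      using kill by (intro sum.cong) auto
    finally show ?thesis by (simp add: finite id_mem)
  qed
  then have "(\<lambda>f. - (act s ?q \<xi> f - poly ?q s * \<xi> f)) = (\<lambda>f. disc s ^ Suc n * \<xi> f)"
    by (simp add: poly_power poly_Q_id del: power_Suc)
  \<comment> \<open>Here all of S serves as multipliers, so \<open>act_leading\<close> applies
    although the coefficients of \<open>Q s id\<close> are not invariant in general.\<close>
  moreover have "(\<lambda>f. - (act s ?q \<xi> f - poly ?q s * \<xi> f)) \<in> ord_less \<iota> UNIV n"
    by (intro ord_less_uminus act_leading Suc.prems) simp
  ultimately have "(\<lambda>f. disc s ^ Suc n * \<xi> f) \<in> ord_less \<iota> UNIV n" by simp
  moreover have "disc s ^ m \<noteq> 0" for m
    using assms(1) nzd id_mem by (induction m) (auto dest: nzd)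
  ultimately have "\<xi> \<in> ord_less \<iota> UNIV n"
    using nzd by (blast intro: ord_less_lmult_cancel)
  then show ?case using Suc by blast
qed

lemma diff_op_eqI:
  assumes "disc s \<noteq> 0" and \<xi>: "\<xi> \<in> ord_less \<iota> UNIV m" and \<eta>: "\<eta> \<in> ord_less \<iota> UNIV n"
    and "\<And>r. r \<in> R \<Longrightarrow> \<xi> r = \<eta> r"
  shows "\<xi> = \<eta>"
proof -
  have "(\<lambda>f. \<xi> f - \<eta> f) \<in> ord_less \<iota> UNIV (max m n)"
    by (intro ord_less_diff ord_less_mono[OF \<xi>] ord_less_mono[OF \<eta>]) auto
  from diff_op_eq_zero[OF assms(1) this] assms(4) have "(\<lambda>f. \<xi> f - \<eta> f) = (\<lambda>_. 0)" by simp
  then show ?thesis by (simp add: fun_eq_iff)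
qed

text \<open>Two extensions with denominators are at hand. Cross-multiplied they agree on R, hence
  everywhere by uniqueness, and Euclid's lemma shows that one denominator divides its numerator
  pointwise.\<close>

lemma extend:
  assumes "disc s \<noteq> 0" "disc t \<noteq> 0"
    and coprime: "\<And>M N g. disc s ^ M dvd disc t ^ N * g \<Longrightarrow> disc s ^ M dvd g"
    and "\<xi> \<in> ord_less \<iota> R n"
  shows "\<exists>\<eta>\<in>ord_less \<iota> UNIV n. \<forall>r\<in>R. \<eta> r = \<xi> r"
proof -
  obtain M \<alpha> where \<alpha>: "\<alpha> \<in> ord_less \<iota> UNIV n" "\<forall>r\<in>R. \<alpha> r = disc s ^ M * \<xi> r"
    using extend_with_denominator[OF assms(1,4)] by blast
  obtain N \<beta> where \<beta>: "\<beta> \<in> ord_less \<iota> UNIV n" "\<forall>r\<in>R. \<beta> r = disc t ^ N * \<xi> r"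
    using extend_with_denominator[OF assms(2,4)] by blast
  have "(\<lambda>f. disc t ^ N * \<alpha> f) = (\<lambda>f. disc s ^ M * \<beta> f)"
    by (rule diff_op_eqI[OF assms(1), of _ n _ n])
      (simp_all add: \<alpha> \<beta> ord_less_lmult mult.left_commute)
  then have "disc s ^ M dvd disc t ^ N * \<alpha> f" for f by (metis dvd_triv_left)
  then have "\<forall>f. \<exists>h. \<alpha> f = disc s ^ M * h" using coprime by (meson dvd_def)
  \<comment> \<open>The quotient is chosen value by value; that it is a differential operator
    follows only from cancelling \<open>disc s ^ M\<close>.\<close>
  then obtain \<eta> where \<eta>: "\<And>f. \<alpha> f = disc s ^ M * \<eta> f" by metis
  have nz: "disc s ^ M \<noteq> 0" using assms(1) nzd by (induction M) auto
  have "(\<lambda>f. disc s ^ M * \<eta> f) \<in> ord_less \<iota> UNIV n" using \<alpha>(1) by (simp add: \<eta>[symmetric])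
  then have "\<eta> \<in> ord_less \<iota> UNIV n" using nzd nz by (blast intro: ord_less_lmult_cancel)
  moreover have "\<eta> r = \<xi> r" if "r \<in> R" for r
    using \<alpha>(2) \<eta>[of r] that nzd[OF _, of "disc s ^ M" "\<eta> r - \<xi> r"] nz
    by (auto simp: algebra_simps)
  ultimately show ?thesis by blast
qed

end

section \<open>Polynomials in several variables\<close>

abbreviation (input) "lookup \<equiv> Poly_Mapping.lookup"
abbreviation (input) "keys \<equiv> Poly_Mapping.keys"
abbreviation (input) "single \<equiv> Poly_Mapping.single"

text \<open>Extension from monomials by additivity. Substitutions, derivatives and the passage from
  symbols to operators are all of this form, so additivity and multiplicativity reduce to conditions
  on \<open>h\<close>.\<close>

definition lext :: "('a \<Rightarrow> 'b \<Rightarrow> 'c) \<Rightarrow> ('a \<Rightarrow>\<^sub>0 'b::zero) \<Rightarrow> 'c::comm_monoid_add" where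
  "lext h f = (\<Sum>m\<in>keys f. h m (lookup f m))"

lemma lext_superset:
  assumes "\<And>m. h m 0 = 0" "finite A" "keys f \<subseteq> A"
  shows "lext h f = (\<Sum>m\<in>A. h m (lookup f m))"
  unfolding lext_def using assms
  by (intro sum.mono_neutral_left) (auto simp: in_keys_iff)

lemma lext_single: "h m 0 = 0 \<Longrightarrow> lext h (single m c) = h m c"
  by (simp add: lext_def)

lemma lext_zero: "lext h 0 = 0"
  by (simp add: lext_def)

lemma lext_add:
  assumes "\<And>m a b. h m (a + b) = h m a + h m b" "\<And>m. h m 0 = 0"
  shows "lext h (f + g) = lext h f + lext h g"
proof -
  let ?A = "keys f \<union> keys g"
  have "keys (f + g) \<subseteq> ?A" by (rule Poly_Mapping.keys_add)
  then show ?thesis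
    using assms by (simp add: lext_superset[of h ?A] lookup_add sum.distrib)
qed

lemma poly_mapping_single_induct:
  fixes f :: "'a \<Rightarrow>\<^sub>0 'b::comm_monoid_add"
  assumes "\<And>m c. P (single m c)" "\<And>f g. P f \<Longrightarrow> P g \<Longrightarrow> P (f + g)"
  shows "P f"
proof -
  have "f = (\<Sum>m\<in>keys f. single m (lookup f m))"
    by (rule poly_mapping_eqI) (auto simp: lookup_sum lookup_single when_def in_keys_iff)
  moreover have "P (\<Sum>m\<in>X. single m (lookup f m))" if "finite X" for X
    using that
  proof (induction X rule: finite_induct)
    case empty
    \<comment> \<open>Zero is the monomial with coefficient 0, at any exponent.\<close>
    show ?case using assms(1)[of undefined 0] by simp
  next
    case (insert m X)
    then show ?case by (simp add: assms)
  qed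
  ultimately show ?thesis using finite_keys by metis
qed

lemma lext_mult:
  fixes h :: "'a::cancel_comm_monoid_add \<Rightarrow> 'b::comm_semiring_0 \<Rightarrow> 'c::comm_semiring_0"
  assumes h: "\<And>m a b. h m (a + b) = h m a + h m b" "\<And>m. h m 0 = 0"
    and mult: "\<And>m n a b. h (m + n) (a * b) = h m a * h n b"
  shows "lext h (f * g) = lext h f * lext h g"
proof (induction f rule: poly_mapping_single_induct)
  case (1 m c)
  show ?case
    by (induction g rule: poly_mapping_single_induct)
      (simp_all add: mult_single lext_single h mult distrib_left lext_add)
next
  case (2 f1 f2)
  then show ?case by (simp add: distrib_right lext_add h)
qed

text \<open>Exponents indexed by \<open>nat\<close> carry a linear order compatible with addition,
  so polynomials over them form a domain. Numbering the finitely many variables embeds the ring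
  multiplicatively into that domain.\<close>

lemma mpoly_nzd:
  fixes f g :: "('k::field, 'n::finite) mpoly"
  assumes "f * g = 0"
  shows "f = 0 \<or> g = 0"
proof -
  obtain e :: "'n \<Rightarrow> nat" where e: "inj e"
    using finite_imp_inj_to_nat_seg[OF finite[of "UNIV :: 'n set"]] by auto
  define E :: "('n \<Rightarrow>\<^sub>0 nat) \<Rightarrow> (nat \<Rightarrow>\<^sub>0 nat)" where
    "E m = (\<Sum>j\<in>UNIV. single (e j) (lookup m j))" for m
  have lookup_E: "lookup (E m) (e j) = lookup m j" for m j
    using e by (simp add: E_def lookup_sum lookup_single when_def inj_eq)
  have E_add: "E (m + m') = E m + E m'" for m m'
    by (simp add: E_def lookup_add single_add sum.distrib)
  have "inj E" by (intro injI poly_mapping_eqI) (metis lookup_E)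
  define \<Phi> :: "('k, 'n) mpoly \<Rightarrow> (nat \<Rightarrow>\<^sub>0 nat) \<Rightarrow>\<^sub>0 'k" where
    "\<Phi> = lext (\<lambda>m c. single (E m) c)"
  have "\<Phi> f * \<Phi> g = \<Phi> (f * g)"
    unfolding \<Phi>_def by (rule lext_mult[symmetric]) (simp_all add: single_add E_add mult_single)
  then have "\<Phi> f = 0 \<or> \<Phi> g = 0" using assms by (simp add: \<Phi>_def lext_zero)
  moreover have "h = 0" if "\<Phi> h = 0" for h
  proof (rule poly_mapping_eqI)
    fix m
    have "lookup (\<Phi> h) (E m) = (\<Sum>m'\<in>keys h. if m' = m then lookup h m' else 0)"
      using \<open>inj E\<close> by (auto simp: \<Phi>_def lext_def lookup_sum lookup_single when_def inj_eq intro!: sum.cong)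
    also have "\<dots> = lookup h m" by (simp add: in_keys_iff)
    finally show "lookup h m = lookup 0 m" using that by simp
  qed
  ultimately show ?thesis by blast
qed

lemma mconst_add: "mconst (a + b) = mconst a + mconst b"
  by (simp add: mconst_def single_add)

lemma mconst_mult: "mconst (a * b) = mconst a * mconst b"
  by (simp add: mconst_def mult_single)

lemma mconst_0 [simp]: "mconst 0 = 0"
  by (simp add: mconst_def)

lemma mconst_1 [simp]: "mconst 1 = 1"
  by (simp add: mconst_def)

lemma mconst_diff: "mconst (a - b) = mconst a - mconst b"
  by (simp add: mconst_def single_diff)

lemma mconst_sum: "mconst (\<Sum>x\<in>X. h x) = (\<Sum>x\<in>X. mconst (h x))"
  by (induction X rule: infinite_finite_induct) (simp_all add: mconst_add)

lemma mconst_mult_single: "mconst a * single m c = single m (a * c)"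
  by (simp add: mconst_def mult_single)

lemma mvar_power: "mvar j ^ e = single (single j e) 1"
  by (induction e) (simp_all add: mvar_def mult_single single_add[symmetric] add.commute)

lemma prod_single: "(\<Prod>x\<in>X. single (h x) (1::'k::field)) = single (\<Sum>x\<in>X. h x) 1"
  by (induction X rule: infinite_finite_induct) (simp_all add: mult_single)

lemma sum_single_lookup: "(\<Sum>j\<in>UNIV. single j (lookup m j)) = (m :: 'n::finite \<Rightarrow>\<^sub>0 nat)"
  by (rule poly_mapping_eqI) (simp add: lookup_sum lookup_single when_def)

lemma single_eq_prod:
  "single m (c::'k::field) = mconst c * (\<Prod>j\<in>UNIV. mvar j ^ lookup m (j::'n::finite))"
  by (simp add: mvar_power prod_single sum_single_lookup mconst_def mult_single)

lemma mpoly_induct [case_names const var add mult]: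
  fixes f :: "('k::field, 'n::finite) mpoly"
  assumes const: "\<And>c. P (mconst c)" and var: "\<And>i. P (mvar i)"
    and add: "\<And>f g. P f \<Longrightarrow> P g \<Longrightarrow> P (f + g)" and mult: "\<And>f g. P f \<Longrightarrow> P g \<Longrightarrow> P (f * g)"
  shows "P f"
proof (induction f rule: poly_mapping_single_induct)
  case (1 m c)
  have P1: "P 1" using const[of 1] by simp
  have "P (f ^ n)" if "P f" for f n by (induction n) (simp_all add: P1 mult that)
  then have "P (\<Prod>j\<in>X. mvar j ^ lookup m j)" for X
    by (induction X rule: infinite_finite_induct) (simp_all add: P1 mult var)
  then show ?case unfolding single_eq_prod by (intro mult const)
qed (rule add)

section \<open>Linear forms and the action of matrices by substitution\<close>

definition linform :: "'k::field ^ 'n::finite \<Rightarrow> ('k, 'n) mpoly" where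
  "linform v = (\<Sum>i\<in>UNIV. mconst (v $ i) * mvar i)"

lemma linform_axis: "linform (axis j 1) = mvar j"
proof -
  have "linform (axis j 1) = (\<Sum>i\<in>UNIV. if i = j then mvar i else 0)"
    unfolding linform_def by (intro sum.cong) (simp_all add: axis_def)
  then show ?thesis by simp
qed

lemma linform_diff: "linform (v - w) = linform v - linform w"
  by (simp add: linform_def mconst_diff left_diff_distrib sum_subtractf)

lemma linform_scale: "linform (c *s v) = mconst c * linform v"
  by (simp add: linform_def mconst_mult sum_distrib_left mult.assoc)

lemma single_1_eqD: "single i (Suc 0) = single j (Suc 0) \<Longrightarrow> i = j"
  by (drule arg_cong[of _ _ "\<lambda>m. lookup m j"]) (simp add: lookup_single when_def split: if_splits)

lemma lookup_linform: "lookup (linform v) (single i 1) = v $ i"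
proof -
  have "lookup (linform v) (single i 1) = (\<Sum>j\<in>UNIV. if j = i then v $ j else 0)"
    unfolding linform_def lookup_sum
    by (intro sum.cong)
      (auto simp: mvar_def mconst_mult_single lookup_single when_def dest: single_1_eqD)
  then show ?thesis by simp
qed

lemma linform_eq_0_iff: "linform v = 0 \<longleftrightarrow> v = 0"
proof
  assume "linform v = 0"
  then show "v = 0" using lookup_linform[of v] by (simp add: vec_eq_iff)
qed (simp add: linform_def)

lemma lin_act_lext:
  "lin_act \<gamma> = lext (\<lambda>m c. mconst c * (\<Prod>j\<in>UNIV. linform (column j \<gamma>) ^ lookup m j))"
  by (rule ext) (simp add: lin_act_def lext_def linform_def column_def)

lemma lin_act_add: "lin_act \<gamma> (f + g) = lin_act \<gamma> f + lin_act \<gamma> g"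
  unfolding lin_act_lext by (rule lext_add) (simp_all add: mconst_add distrib_right)

lemma lin_act_mult: "lin_act \<gamma> (f * g) = lin_act \<gamma> f * lin_act \<gamma> g"
  unfolding lin_act_lext
  by (rule lext_mult)
    (simp_all add: mconst_add mconst_mult distrib_right lookup_add power_add prod.distrib
      mult.assoc mult.left_commute)

lemma lin_act_mconst [simp]: "lin_act \<gamma> (mconst c) = mconst c"
  unfolding lin_act_lext by (simp add: mconst_def[of c] lext_single)

lemma lin_act_0 [simp]: "lin_act \<gamma> 0 = 0"
  using lin_act_mconst[of \<gamma> 0] by simp

lemma lin_act_1 [simp]: "lin_act \<gamma> 1 = 1"
  using lin_act_mconst[of \<gamma> 1] by simp

lemma lin_act_sum: "lin_act \<gamma> (\<Sum>x\<in>X. h x) = (\<Sum>x\<in>X. lin_act \<gamma> (h x))"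
  by (induction X rule: infinite_finite_induct) (simp_all add: lin_act_add)

lemma lin_act_minus: "lin_act \<gamma> (- f) = - lin_act \<gamma> f"
  using lin_act_add[of \<gamma> f "- f"] by (simp add: minus_unique)

lemma lin_act_mvar: "lin_act \<gamma> (mvar j) = linform (column j \<gamma>)"
proof -
  have "lin_act \<gamma> (mvar j) = (\<Prod>l\<in>UNIV. if l = j then linform (column l \<gamma>) else 1)"
    unfolding lin_act_lext mvar_def
    by (subst lext_single)
      (simp_all add: lookup_single when_def if_distrib[of "power _"] eq_commute[of j] cong: if_cong)
  then show ?thesis by simp
qed

lemma lin_act_linform: "lin_act \<gamma> (linform v) = linform (\<gamma> *v v)"
proof -
  have "lin_act \<gamma> (linform v) = (\<Sum>j\<in>UNIV. \<Sum>i\<in>UNIV. mconst (v $ j) * (mconst (\<gamma> $ i $ j) * mvar i))"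
    unfolding linform_def[of v] lin_act_sum lin_act_mult lin_act_mvar lin_act_mconst
    by (simp add: linform_def column_def sum_distrib_left)
  also have "\<dots> = linform (\<gamma> *v v)"
    by (subst sum.swap)
      (simp add: linform_def matrix_vector_mult_def mconst_sum mconst_mult sum_distrib_left
        sum_distrib_right ac_simps)
  finally show ?thesis .
qed

lemma lin_act_compose: "lin_act A (lin_act B f) = lin_act (A ** B) f"
proof (induction f rule: mpoly_induct)
  case (var i)
  have "A *v column i B = column i (A ** B)"
    by (simp add: vec_eq_iff column_def matrix_vector_mult_def matrix_matrix_mult_def)
  then show ?case by (simp add: lin_act_mvar lin_act_linform)
qed (simp_all add: lin_act_add lin_act_mult)

lemma lin_act_mat_1: "lin_act (mat 1) (f :: ('k::field, 'n::finite) mpoly) = f"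
proof (induction f rule: mpoly_induct)
  case (var i)
  have "column i (mat 1) = (axis i 1 :: 'k ^ 'n)" by (simp add: vec_eq_iff column_def mat_def axis_def)
  then show ?case by (simp add: lin_act_mvar linform_axis)
qed (simp_all add: lin_act_add lin_act_mult)

section \<open>Coprime linear forms\<close>

text \<open>In a domain without unique factorization at hand, \<open>a\<close> and \<open>b\<close> coprime is expressed by
  Euclid's lemma.\<close>

definition nzd_mod :: "'a::comm_ring_1 \<Rightarrow> 'a \<Rightarrow> bool" where
  "nzd_mod a b \<longleftrightarrow> (\<forall>g. a dvd b * g \<longrightarrow> a dvd g)"

lemma nzd_mod_mult_right: "nzd_mod a b \<Longrightarrow> nzd_mod a b' \<Longrightarrow> nzd_mod a (b * b')"
  unfolding nzd_mod_def mult.assoc by blast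

lemma nzd_modD: "nzd_mod a b \<Longrightarrow> a dvd b * g \<Longrightarrow> a dvd g"
  by (auto simp only: nzd_mod_def)

lemma nzd_mod_1_right: "nzd_mod a 1" and nzd_mod_1_left: "nzd_mod 1 b"
  by (simp_all add: nzd_mod_def)

lemma nzd_mod_mult_left:
  fixes a :: "('k::field, 'n::finite) mpoly"
  assumes "a \<noteq> 0" "nzd_mod a b" "nzd_mod a' b"
  shows "nzd_mod (a * a') b"
  unfolding nzd_mod_def
proof (intro allI impI)
  fix g assume "a * a' dvd b * g"
  then obtain q where q: "b * g = a * a' * q" by (elim dvdE)
  then have "a dvd b * g" by (simp add: mult.assoc)
  then have "a dvd g" by (rule nzd_modD[OF assms(2)])
  then obtain h where h: "g = a * h" by (elim dvdE)
  have "a * (b * h - a' * q) = 0"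
    using q unfolding h right_diff_distrib by (simp add: ac_simps)
  then have "b * h - a' * q = 0" using mpoly_nzd assms(1) by blast
  then have "a' dvd b * h" by simp
  then have "a' dvd h" by (rule nzd_modD[OF assms(3)])
  then show "a * a' dvd g" unfolding h by (rule mult_dvd_mono[OF dvd_refl])
qed

lemma nzd_mod_power_right: "nzd_mod a b \<Longrightarrow> nzd_mod a (b ^ n)"
  by (induction n) (auto intro: nzd_mod_mult_right nzd_mod_1_right)

lemma nzd_mod_power_left:
  fixes a :: "('k::field, 'n::finite) mpoly"
  shows "a \<noteq> 0 \<Longrightarrow> nzd_mod a b \<Longrightarrow> nzd_mod (a ^ n) b"
  by (induction n) (auto intro: nzd_mod_mult_left nzd_mod_1_left)

lemma nzd_mod_prod_right: "(\<And>x. x \<in> X \<Longrightarrow> nzd_mod a (b x)) \<Longrightarrow> nzd_mod a (\<Prod>x\<in>X. b x)"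
  by (induction X rule: infinite_finite_induct) (auto intro: nzd_mod_mult_right nzd_mod_1_right)

lemma nzd_mod_prod_left:
  fixes a :: "_ \<Rightarrow> ('k::field, 'n::finite) mpoly"
  shows "(\<And>x. x \<in> X \<Longrightarrow> a x \<noteq> 0 \<and> nzd_mod (a x) b) \<Longrightarrow> nzd_mod (\<Prod>x\<in>X. a x) b"
  by (induction X rule: infinite_finite_induct) (auto intro: nzd_mod_mult_left nzd_mod_1_left)

text \<open>A linear projection with kernel spanned by \<open>u\<close> induces a ring homomorphism whose kernel is
  generated by the linear form \<open>u\<close>, and its image is a domain.\<close>

lemma nzd_mod_linform:
  fixes u v :: "'k::field ^ 'n::finite"
  assumes "u \<noteq> 0" and "\<And>c. v \<noteq> c *s u"
  shows "nzd_mod (linform u) (linform v)"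
proof -
  obtain i where i: "u $ i \<noteq> 0" using assms(1) by (auto simp: vec_eq_iff)
  \<comment> \<open>The projection along \<open>u\<close> that clears coordinate \<open>i\<close>.
    It is singular, but \<open>lin_act\<close> is plain substitution and still a ring
    homomorphism.\<close>
  define \<pi> :: "'k ^ 'n ^ 'n" where
    "\<pi> = (\<chi> r c. mat 1 $ r $ c - (if c = i then u $ r / u $ i else 0))"
  have \<pi>: "\<pi> *v w = w - (w $ i / u $ i) *s u" for w
  proof -
    have "(\<Sum>c\<in>UNIV. (mat 1 $ r $ c - (if c = i then u $ r / u $ i else 0)) * w $ c) =
      (\<Sum>c\<in>UNIV. if c = r then w $ c else 0) - (\<Sum>c\<in>UNIV. if c = i then u $ r / u $ i * w $ c else 0)" for r
      unfolding sum_subtractf[symmetric]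
      by (intro sum.cong) (auto simp: mat_def algebra_simps)
    then show ?thesis
      by (simp add: vec_eq_iff matrix_vector_mult_def \<pi>_def)
  qed
  have dvd: "linform u dvd f - lin_act \<pi> f" for f
  proof (induction f rule: mpoly_induct)
    case (const c)
    then show ?case by simp
  next
    case (var j)
    have "mvar j - lin_act \<pi> (mvar j) = linform (axis j 1 - \<pi> *v axis j 1)"
      by (simp add: linform_axis[symmetric] lin_act_linform linform_diff)
    also have "\<dots> = mconst (axis j 1 $ i / u $ i) * linform u"
      by (simp add: \<pi> linform_scale)
    finally show ?case by simp
  next
    case (add f g)
    then have "linform u dvd (f - lin_act \<pi> f) + (g - lin_act \<pi> g)" by (rule dvd_add)
    then show ?case by (simp add: lin_act_add algebra_simps)
  next
    case (mult f g)
    then have "linform u dvd (f - lin_act \<pi> f) * g + lin_act \<pi> f * (g - lin_act \<pi> g)"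
      by (intro dvd_add dvd_mult dvd_mult2)
    then show ?case by (simp add: lin_act_mult algebra_simps)
  qed
  have "lin_act \<pi> (linform u) = 0"
    using i by (simp add: lin_act_linform \<pi> linform_eq_0_iff)
  then have dvd_iff: "linform u dvd f \<longleftrightarrow> lin_act \<pi> f = 0" for f
    using dvd[of f] by (auto simp: lin_act_mult elim!: dvdE)
  have "lin_act \<pi> (linform v) \<noteq> 0"
    using assms(2)[of "v $ i / u $ i"] by (simp add: lin_act_linform \<pi> linform_eq_0_iff)
  then show ?thesis
    using mpoly_nzd by (auto simp: nzd_mod_def dvd_iff lin_act_mult)
qed

section \<open>Generic vectors\<close>

text \<open>Take \<open>x\<close> outside the old subspaces. If it lies in the new one, shift some
  \<open>y\<close> outside \<open>V\<close> along \<open>x\<close>: the line stays outside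
  \<open>V\<close> and meets each old subspace at most once, so an infinite field leaves a good
  parameter.\<close>

lemma exists_avoiding_subspaces:
  fixes \<U> :: "('k::field_char_0 ^ 'n::finite) set set"
  assumes "finite \<U>" and "\<And>U. U \<in> \<U> \<Longrightarrow> vec.subspace U \<and> U \<noteq> UNIV"
  shows "\<exists>v. \<forall>U\<in>\<U>. v \<notin> U"
  using assms
proof (induction \<U> rule: finite_induct)
  case (insert V \<U>)
  obtain x where x: "\<And>U. U \<in> \<U> \<Longrightarrow> x \<notin> U" using insert by auto
  show ?case
  proof (cases "x \<in> V")
    case True
    have V: "vec.subspace V" "V \<noteq> UNIV" using insert.prems by auto
    then obtain y where y: "y \<notin> V" by blast
    have "finite {t. y + t *s x \<in> U}" if "U \<in> \<U>" for U
    proof -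
      have U: "vec.subspace U" using insert.prems that by auto
      have "t = t'" if "y + t *s x \<in> U" "y + t' *s x \<in> U" for t t'
      proof (rule ccontr)
        assume "t \<noteq> t'"
        have "(t - t') *s x \<in> U"
          using vec.subspace_diff[OF U that] by (simp add: vec.scale_left_diff_distrib)
        then have "inverse (t - t') *s ((t - t') *s x) \<in> U" by (rule vec.subspace_scale[OF U])
        then show False using x[OF \<open>U \<in> \<U>\<close>] \<open>t \<noteq> t'\<close> by simp
      qed
      then have "{t. y + t *s x \<in> U} = {} \<or> (\<exists>t. {t. y + t *s x \<in> U} = {t})" by blast
      then show ?thesis by auto
    qed
    then have "finite (\<Union>U\<in>\<U>. {t. y + t *s x \<in> U})" using insert.hyps by blast
    then obtain t where t: "t \<notin> (\<Union>U\<in>\<U>. {t. y + t *s x \<in> U})"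
      using infinite_UNIV_char_0 ex_new_if_finite by metis
    have "y + t *s x \<notin> V"
      using vec.subspace_diff[OF V(1) _ vec.subspace_scale[OF V(1) True], of "y + t *s x" t] y by auto
    with t show ?thesis by (intro exI[of _ "y + t *s x"]) auto
  qed (use x in auto)
qed auto

text \<open>If \<gamma> - 1 mapped everything into the line of \<open>u\<close>, its kernel would
  have codimension one and \<gamma> would be a pseudoreflection.\<close>

lemma not_pseudoreflection_rank:
  fixes \<gamma> :: "'k::field ^ 'n ^ 'n::finite"
  assumes "invertible \<gamma>" "\<gamma> \<noteq> mat 1" "\<not> pseudoreflection \<gamma>"
  shows "\<exists>v. \<forall>c. \<gamma> *v v - v \<noteq> c *s u"
proof (rule ccontr)
  assume "\<not> ?thesis"
  then obtain \<phi> where \<phi>: "\<And>v. \<gamma> *v v - v = \<phi> v *s u" by metis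
  define H where "H = {v. \<gamma> *v v = v}"
  have H: "vec.subspace H"
    by (rule vec.subspaceI)
      (auto simp: H_def matrix_vector_right_distrib vector_scalar_commute)
  obtain e where e: "\<gamma> *v e \<noteq> e" using assms(2) by (metis matrix_eq matrix_vector_mul_lid)
  then have \<phi>e: "\<phi> e \<noteq> 0" using \<phi>[of e] by auto
  have "v \<in> vec.span (insert e H)" for v
  proof -
    \<comment> \<open>Chosen so that \<gamma> - 1 cancels on \<open>v - t *s e\<close>: the fixed
      space and one moved vector \<open>e\<close> together span everything.\<close>
    define t where "t = \<phi> v / \<phi> e"
    have "\<gamma> *v (v - t *s e) - (v - t *s e) = (\<gamma> *v v - v) - t *s (\<gamma> *v e - e)"
      by (simp add: matrix_vector_mult_diff_distrib vector_scalar_commute vec.scale_right_diff_distrib)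
    also have "\<dots> = 0" using \<phi>e by (simp add: \<phi> t_def)
    finally have "v - t *s e \<in> H" by (simp add: H_def)
    then have "v - t *s e \<in> vec.span (insert e H)" by (simp add: vec.span_base)
    moreover have "t *s e \<in> vec.span (insert e H)" by (simp add: vec.span_base vec.span_scale)
    ultimately have "(v - t *s e) + t *s e \<in> vec.span (insert e H)" by (rule vec.span_add)
    then show ?thesis by simp
  qed
  then have "vec.span (insert e H) = UNIV" by blast
  then have "vec.dim (insert e H) = CARD('n)"
    using vec.dim_span[of "insert e H"] by (simp only: vec_dim_card)
  moreover have "e \<notin> vec.span H"
    unfolding vec.span_eq_iff[THEN iffD2, OF H] using e by (simp add: H_def)
  ultimately have dim: "vec.dim H = CARD('n) - 1" by (simp add: vec.dim_insert)
  have "\<forall>v\<in>H. \<gamma> *v v = v" by (simp add: H_def)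
  then have "pseudoreflection \<gamma>"
    unfolding pseudoreflection_def using assms(1,2) H dim by blast
  then show False using assms(3) by contradiction
qed

section \<open>Normal forms in the Weyl algebra\<close>

lemma mpderiv_lext:
  "mpderiv i = lext (\<lambda>m c. single (m - single i 1) (of_nat (lookup m i) * c))"
  by (rule ext) (simp add: mpderiv_def lext_def)

lemma mpderiv_single:
  "mpderiv i (single m c) = single (m - single i 1) (of_nat (lookup m i) * c)"
  by (simp add: mpderiv_lext lext_single)

lemma mpderiv_add: "mpderiv i (f + g) = mpderiv i f + mpderiv i g"
  unfolding mpderiv_lext by (rule lext_add) (simp_all add: distrib_left single_add)

lemma mpderiv_mult:
  fixes f g :: "('k::field, 'n) mpoly"
  shows "mpderiv i (f * g) = mpderiv i f * g + f * mpderiv i g"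
proof (induction f rule: poly_mapping_single_induct)
  case (1 m a)
  show ?case
  proof (induction g rule: poly_mapping_single_induct)
    case (1 n b)
    have shift: "single (m' - single i 1 + n') (of_nat (lookup m' i) * c) =
        single (m' + n' - single i 1) (of_nat (lookup m' i) * c)" for m' n' and c :: 'k
    proof (cases "lookup m' i = 0")
      case False
      then have "m' - single i 1 + n' = m' + n' - single i 1"
        by (intro poly_mapping_eqI) (auto simp: lookup_add lookup_minus lookup_single when_def)
      then show ?thesis by simp
    qed simp
    show ?case
      using shift[of m n "a * b"] shift[of n m "a * b"]
      by (simp add: mult_single mpderiv_single lookup_add single_add[symmetric] distrib_right
          distrib_left ac_simps)
  qed (simp add: distrib_left mpderiv_add)
qed (simp add: distrib_right mpderiv_add)

lemma mpderiv_mconst [simp]: "mpderiv i (mconst c) = 0"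
  by (simp add: mconst_def mpderiv_single)

lemma mpderiv_mvar: "mpderiv i (mvar j) = (if i = j then 1 else 0)"
  by (simp add: mvar_def mpderiv_single lookup_single when_def)

lemma mpderiv_mconst_mult: "mpderiv i (mconst c * f) = mconst c * mpderiv i f"
  by (simp add: mpderiv_mult)

text \<open>Both sides are derivations that kill constants, so they need only be compared on the
  variables. It will be applied to a derivative conjugated by a matrix.\<close>

lemma derivation_eq_sum:
  fixes D :: "('k::field, 'n::finite) mpoly \<Rightarrow> ('k, 'n) mpoly"
  assumes "\<And>f g. D (f + g) = D f + D g" "\<And>f g. D (f * g) = D f * g + f * D g"
    and "\<And>c. D (mconst c) = 0"
  shows "D f = (\<Sum>j\<in>UNIV. D (mvar j) * mpderiv j f)"
proof (induction f rule: mpoly_induct)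
  case (var i)
  have "(\<Sum>j\<in>UNIV. D (mvar j) * mpderiv j (mvar i)) = (\<Sum>j\<in>UNIV. if j = i then D (mvar j) else 0)"
    by (intro sum.cong) (simp_all add: mpderiv_mvar)
  then show ?case by simp
next
  case (mult f g)
  then show ?case
    by (simp add: assms mpderiv_mult distrib_left sum.distrib sum_distrib_left sum_distrib_right
        ac_simps)
qed (simp_all add: assms mpderiv_add distrib_left sum.distrib)

section \<open>Iterated derivatives and symbols\<close>

primrec falling :: "nat \<Rightarrow> nat \<Rightarrow> nat" where
  "falling m 0 = 1"
| "falling m (Suc a) = falling m a * (m - a)"

lemma falling_Suc_left: "falling m (Suc a) = m * falling (m - 1) a"
  by (induction a) simp_all

lemma falling_self: "falling m m = fact m"
proof (induction m)
  case (Suc m)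
  then show ?case unfolding falling_Suc_left by simp
qed simp

lemma falling_eq_0: "m < a \<Longrightarrow> falling m a = 0"
  by (induction a) (auto simp: less_Suc_eq)

text \<open>The operator \<open>\<partial>\<^sup>\<alpha>\<close>; on a monomial not divisible by \<open>x\<^sup>\<alpha>\<close> the
  falling factorials vanish, so the truncated exponent is harmless.\<close>

definition dpow :: "('n \<Rightarrow>\<^sub>0 nat) \<Rightarrow> ('k::field, 'n::finite) mpoly \<Rightarrow> ('k, 'n) mpoly" where
  "dpow \<alpha> = lext (\<lambda>m c. single (m - \<alpha>)
     (of_nat (\<Prod>j\<in>UNIV. falling (lookup m j) (lookup \<alpha> j)) * c))"

lemma dpow_single:
  "dpow \<alpha> (single m c) =
    single (m - \<alpha>) (of_nat (\<Prod>j\<in>UNIV. falling (lookup m j) (lookup \<alpha> j)) * c)"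
  unfolding dpow_def by (rule lext_single) simp

lemma dpow_add: "dpow \<alpha> (f + g) = dpow \<alpha> f + dpow \<alpha> g"
  unfolding dpow_def by (rule lext_add) (simp_all add: distrib_left single_add)

lemma dpow_0 [simp]: "dpow \<alpha> 0 = 0"
  by (simp add: dpow_def lext_zero)

lemma dpow_zero_index: "dpow 0 f = f"
  by (induction f rule: poly_mapping_single_induct) (simp_all add: dpow_single dpow_add)

lemma prod_falling_step:
  fixes \<alpha> :: "'n::finite \<Rightarrow>\<^sub>0 nat"
  shows "(\<Prod>j\<in>UNIV. falling (lookup m j) (lookup (\<alpha> + single i 1) j)) =
    falling (lookup m i) (Suc (lookup \<alpha> i)) *
      (\<Prod>j\<in>UNIV-{i}. falling (lookup m j) (lookup \<alpha> j))"
proof -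
  have "(\<Prod>j\<in>UNIV-{i}. falling (lookup m j) (lookup (\<alpha> + single i 1) j)) =
      (\<Prod>j\<in>UNIV-{i}. falling (lookup m j) (lookup \<alpha> j))"
    by (intro prod.cong) (auto simp: lookup_add lookup_single when_def)
  then show ?thesis
    by (subst prod.remove[of UNIV i]) (simp_all add: lookup_add)
qed

lemma mpderiv_dpow: "mpderiv i (dpow \<alpha> f) = dpow (\<alpha> + single i 1) f"
proof (induction f rule: poly_mapping_single_induct)
  case (1 m c)
  have "m - \<alpha> - single i 1 = m - (\<alpha> + single i 1)"
    by (rule poly_mapping_eqI) (simp add: lookup_add lookup_minus)
  moreover have "(\<Prod>j\<in>UNIV. falling (lookup m j) (lookup (\<alpha> + single i 1) j)) =
      lookup (m - \<alpha>) i * (\<Prod>j\<in>UNIV. falling (lookup m j) (lookup \<alpha> j))"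
    unfolding prod_falling_step
      prod.remove[OF finite UNIV_I, of "\<lambda>j. falling (lookup m j) (lookup \<alpha> j)" i]
    by (simp add: lookup_minus)
  ultimately show ?case by (simp add: dpow_single mpderiv_single mult.assoc)
qed (simp add: dpow_add mpderiv_add)

text \<open>Differentiating first peels the first factor off \<open>falling\<close>, differentiating
  last peels off the last one. Comparing the two gives the commutation of derivatives that
  transposes need.\<close>

lemma dpow_mpderiv: "dpow \<alpha> (mpderiv i f) = dpow (\<alpha> + single i 1) f"
proof (induction f rule: poly_mapping_single_induct)
  case (1 m c)
  have "m - single i 1 - \<alpha> = m - (\<alpha> + single i 1)"
    by (rule poly_mapping_eqI) (simp add: lookup_add lookup_minus add.commute)
  moreover have "(\<Prod>j\<in>UNIV. falling (lookup m j) (lookup (\<alpha> + single i 1) j)) =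
      lookup m i * (\<Prod>j\<in>UNIV. falling (lookup (m - single i 1) j) (lookup \<alpha> j))"
  proof -
    have "(\<Prod>j\<in>UNIV-{i}. falling (lookup (m - single i 1) j) (lookup \<alpha> j)) =
        (\<Prod>j\<in>UNIV-{i}. falling (lookup m j) (lookup \<alpha> j))"
      by (intro prod.cong) (auto simp: lookup_minus lookup_single when_def)
    then show ?thesis
      unfolding prod_falling_step
        prod.remove[OF finite UNIV_I, of "\<lambda>j. falling (lookup (m - single i 1) j) (lookup \<alpha> j)" i]
      by (simp add: falling_Suc_left lookup_minus del: falling.simps)
  qed
  ultimately show ?case by (simp add: dpow_single mpderiv_single ac_simps)
qed (simp add: dpow_add mpderiv_add)

lemma index_induct [case_names zero step]:
  fixes \<alpha> :: "'n \<Rightarrow>\<^sub>0 nat"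
  assumes "P 0" "\<And>\<alpha> i. P \<alpha> \<Longrightarrow> P (\<alpha> + single i 1)"
  shows "P \<alpha>"
proof -
  have add: "P (\<beta> + single i n)" if "P \<beta>" for \<beta> i n
  proof (induction n)
    case (Suc n)
    then have "P (\<beta> + single i n + single i 1)" by (rule assms(2))
    moreover have "\<beta> + single i n + single i 1 = \<beta> + single i (Suc n)"
      by (simp add: add.assoc single_add[symmetric])
    ultimately show ?case by simp
  qed (simp add: that)
  have "P (\<beta> + \<alpha>)" if "P \<beta>" for \<beta>
    using that
    by (induction \<alpha> arbitrary: \<beta> rule: poly_mapping_single_induct)
      (simp_all add: add add.assoc[symmetric])
  from this[OF assms(1)] show ?thesis by simp
qed

type_synonym ('k, 'n) symbol = "('n \<Rightarrow>\<^sub>0 nat) \<Rightarrow>\<^sub>0 ('k, 'n) mpoly"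

text \<open>A symbol \<open>a\<close> stands for \<open>\<Sum> a\<^sub>\<alpha> \<partial>\<^sup>\<alpha>\<close>, and its transpose is
  \<open>\<Sum> (-\<partial>)\<^sup>\<alpha> a\<^sub>\<alpha>\<close>.\<close>

definition quantize :: "('k::field, 'n::finite) symbol \<Rightarrow> ('k, 'n) mpoly \<Rightarrow> ('k, 'n) mpoly" where
  "quantize a f = lext (\<lambda>\<alpha> b. b * dpow \<alpha> f) a"

definition index_sign :: "('n::finite \<Rightarrow>\<^sub>0 nat) \<Rightarrow> 'a::comm_ring_1" where
  "index_sign \<alpha> = (- 1) ^ (\<Sum>j\<in>UNIV. lookup \<alpha> j)"

definition quantize_transpose ::
    "('k::field, 'n::finite) symbol \<Rightarrow> ('k, 'n) mpoly \<Rightarrow> ('k, 'n) mpoly" where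
  "quantize_transpose a f = lext (\<lambda>\<alpha> b. index_sign \<alpha> * dpow \<alpha> (b * f)) a"

lemma quantize_single: "quantize (single \<alpha> b) f = b * dpow \<alpha> f"
  unfolding quantize_def by (rule lext_single) simp

lemma quantize_add: "quantize (a + b) f = quantize a f + quantize b f"
  unfolding quantize_def by (rule lext_add) (simp_all add: distrib_right)

lemma quantize_zero: "quantize 0 f = 0"
  by (simp add: quantize_def lext_zero)

lemma quantize_sum: "quantize (\<Sum>x\<in>X. a x) f = (\<Sum>x\<in>X. quantize (a x) f)"
  by (induction X rule: infinite_finite_induct) (simp_all add: quantize_zero quantize_add)

lemma quantize_transpose_single:
  "quantize_transpose (single \<alpha> b) f = index_sign \<alpha> * dpow \<alpha> (b * f)"
  unfolding quantize_transpose_def by (rule lext_single) simp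

lemma quantize_transpose_add:
  "quantize_transpose (a + b) f = quantize_transpose a f + quantize_transpose b f"
  unfolding quantize_transpose_def
  by (rule lext_add) (simp_all add: distrib_right distrib_left dpow_add)

lemma index_sign_0: "index_sign 0 = 1"
  by (simp add: index_sign_def)

lemma index_sign_Suc: "index_sign (\<alpha> + single i 1) = - index_sign \<alpha>"
proof -
  have "(\<Sum>j\<in>UNIV. lookup (single i 1) j) = (1::nat)"
    by (simp add: lookup_single when_def)
  then show ?thesis by (simp add: index_sign_def lookup_add sum.distrib power_add)
qed

section \<open>Closure properties of the ring of differential operators\<close>

abbreviation D_ring :: "(('k::field, 'n::finite) mpoly \<Rightarrow> ('k, 'n) mpoly) set" where
  "D_ring \<equiv> carrier mpoly_diff_ops"

abbreviation orderS :: "nat \<Rightarrow> (('k::field, 'n::finite) mpoly \<Rightarrow> ('k, 'n) mpoly) set" where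
  "orderS \<equiv> ord_less mconst UNIV"

lemma ord_less_D_ring: "\<xi> \<in> orderS n \<Longrightarrow> \<xi> \<in> D_ring"
  unfolding carrier_diff_op_ring_UNIV by blast

lemma D_ring_alg_End: "\<xi> \<in> D_ring \<Longrightarrow> \<xi> \<in> alg_End mconst UNIV"
  unfolding carrier_diff_op_ring_UNIV by (auto intro: ord_less_alg_End)

lemma D_ring_add: "\<xi> \<in> D_ring \<Longrightarrow> \<eta> \<in> D_ring \<Longrightarrow> (\<lambda>f. \<xi> f + \<eta> f) \<in> D_ring"
  unfolding carrier_diff_op_ring_UNIV
  by (clarsimp simp del: ord_less.simps)
    (metis ord_less_add ord_less_mono nat_le_linear)

lemma D_ring_zero: "(\<lambda>f. 0) \<in> D_ring"
  using ord_less_zero ord_less_D_ring by blast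

lemma D_ring_lmult: "\<xi> \<in> D_ring \<Longrightarrow> (\<lambda>f. a * \<xi> f) \<in> D_ring"
  unfolding carrier_diff_op_ring_UNIV by (blast intro: ord_less_lmult)

lemma D_ring_rmult: "\<xi> \<in> D_ring \<Longrightarrow> (\<lambda>f. \<xi> (a * f)) \<in> D_ring"
  unfolding carrier_diff_op_ring_UNIV by (blast intro: ord_less_rmult)

text \<open>The product rule for commutators leaves two summands, each lowering only one of the
  indices, hence induction on their sum. At index 0 there is nothing to lower, but then the
  commutator vanishes.\<close>

lemma ord_less_comp:
  assumes "\<xi> \<in> ord_less \<iota> UNIV (Suc m)" "\<eta> \<in> ord_less \<iota> UNIV (Suc n)"
  shows "\<xi> \<circ> \<eta> \<in> ord_less \<iota> UNIV (Suc (m + n))"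
  using assms
proof (induction "m + n" arbitrary: m n \<xi> \<eta> rule: less_induct)
  case less
  note \<xi> = ord_less_alg_End[OF less.prems(1)] and \<eta> = ord_less_alg_End[OF less.prems(2)]
  have "ad \<xi> a \<circ> \<eta> \<in> ord_less \<iota> UNIV (m + n)" for a
  proof (cases m)
    case 0
    then have "ad \<xi> a = (\<lambda>_. 0)" using less.prems(1) by simp
    then have "ad \<xi> a \<circ> \<eta> = (\<lambda>_. 0)" by (simp add: fun_eq_iff)
    then show ?thesis by (simp only: ord_less_zero)
  next
    case m: (Suc m')
    have "ad \<xi> a \<circ> \<eta> \<in> ord_less \<iota> UNIV (Suc (m' + n))"
      using less.prems m by (intro less.hyps) (auto intro: ord_less_SucD simp del: ord_less.simps)
    then show ?thesis using m by simp
  qed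
  moreover have "\<xi> \<circ> ad \<eta> a \<in> ord_less \<iota> UNIV (m + n)" for a
  proof (cases n)
    case 0
    then have "ad \<eta> a = (\<lambda>_. 0)" using less.prems(2) by simp
    then have "\<xi> \<circ> ad \<eta> a = (\<lambda>_. 0)" using alg_End_UNIV_0[OF \<xi>] by (simp add: fun_eq_iff)
    then show ?thesis by (simp only: ord_less_zero)
  next
    case n: (Suc n')
    have "\<xi> \<circ> ad \<eta> a \<in> ord_less \<iota> UNIV (Suc (m + n'))"
      using less.prems n by (intro less.hyps) (auto intro: ord_less_SucD simp del: ord_less.simps)
    then show ?thesis using n by simp
  qed
  ultimately have "(\<lambda>f. (ad \<xi> a \<circ> \<eta>) f + (\<xi> \<circ> ad \<eta> a) f) \<in> ord_less \<iota> UNIV (m + n)" for a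
    by (rule ord_less_add)
  moreover have "ad (\<xi> \<circ> \<eta>) a = (\<lambda>f. (ad \<xi> a \<circ> \<eta>) f + (\<xi> \<circ> ad \<eta> a) f)" for a
    by (simp add: fun_eq_iff ad_apply alg_End_UNIV_diff[OF \<xi>])
  ultimately have "ad (\<xi> \<circ> \<eta>) a \<in> ord_less \<iota> UNIV (m + n)" for a by metis
  moreover have "\<xi> \<circ> \<eta> \<in> alg_End \<iota> UNIV"
    unfolding alg_End_UNIV_iff
    by (simp add: alg_End_UNIV_add[OF \<xi>] alg_End_UNIV_add[OF \<eta>] alg_End_UNIV_scale[OF \<xi>]
        alg_End_UNIV_scale[OF \<eta>])
  ultimately show ?case by (intro ord_less_SucI)
qed

lemma D_ring_comp:
  assumes "\<xi> \<in> D_ring" "\<eta> \<in> D_ring" shows "\<xi> \<circ> \<eta> \<in> D_ring"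
proof -
  obtain m n where "\<xi> \<in> orderS m" "\<eta> \<in> orderS n"
    using assms unfolding carrier_diff_op_ring_UNIV by blast
  from ord_less_comp[OF ord_less_Suc[OF this(1)] ord_less_Suc[OF this(2)]]
  show ?thesis by (rule ord_less_D_ring)
qed

lemma id_D_ring: "(\<lambda>f. f) \<in> D_ring"
  by (rule ord_less_D_ring[of _ 1]) (simp add: alg_End_UNIV_iff ad_alt)

lemma mult_D_ring: "(\<lambda>f. a * f) \<in> D_ring"
  using D_ring_lmult[OF id_D_ring] .

lemma mult_order: "(\<lambda>f. a * f) \<in> ord_less \<iota> UNIV (Suc 0)"
  by (simp add: alg_End_UNIV_iff ad_alt distrib_left mult.left_commute)

lemma mpderiv_order: "mpderiv i \<in> orderS (Suc (Suc 0))"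
proof (rule ord_less_SucI)
  show "mpderiv i \<in> alg_End mconst UNIV"
    by (simp add: alg_End_UNIV_iff mpderiv_add mpderiv_mconst_mult)
  fix a
  have "ad (mpderiv i) a = (\<lambda>f. mpderiv i a * f)"
    by (simp add: ad_alt mpderiv_mult)
  then show "ad (mpderiv i) a \<in> orderS (Suc 0)"
    by (simp only: mult_order)
qed

lemma mpderiv_D_ring: "mpderiv i \<in> D_ring"
  using mpderiv_order by (rule ord_less_D_ring)

definition total :: "('n::finite \<Rightarrow>\<^sub>0 nat) \<Rightarrow> nat" where
  "total m = (\<Sum>j\<in>UNIV. lookup m j)"

lemma total_step: "total (m + single i 1) = Suc (total m)"
  by (simp add: total_def lookup_add sum.distrib lookup_single when_def)

lemma dpow_order:
  "(dpow \<alpha> :: ('k::field, 'n::finite) mpoly \<Rightarrow> _) \<in> orderS (Suc (total \<alpha>))"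
proof (induction \<alpha> rule: index_induct)
  case zero
  have "dpow 0 = (\<lambda>f :: ('k, 'n) mpoly. f)" using dpow_zero_index by blast
  moreover have "(\<lambda>f :: ('k, 'n) mpoly. f) \<in> orderS (Suc 0)" by (simp add: alg_End_UNIV_iff ad_alt)
  ultimately show ?case by (simp add: total_def del: ord_less.simps)
next
  case (step \<alpha> i)
  have "dpow (\<alpha> + single i 1) = (mpderiv i \<circ> dpow \<alpha> :: ('k, 'n) mpoly \<Rightarrow> _)"
    by (simp add: fun_eq_iff mpderiv_dpow)
  moreover have "(mpderiv i \<circ> dpow \<alpha> :: ('k, 'n) mpoly \<Rightarrow> _) \<in> orderS (Suc (Suc 0 + total \<alpha>))"
    by (rule ord_less_comp[OF mpderiv_order step])
  ultimately show ?case by (simp only: total_step add_Suc add_0)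
qed

lemma dpow_D_ring: "dpow \<alpha> \<in> D_ring"
  using dpow_order by (rule ord_less_D_ring)

lemma quantize_D_ring: "quantize a \<in> D_ring"
proof (induction a rule: poly_mapping_single_induct)
  case (1 \<alpha> b)
  have "quantize (single \<alpha> b) = (\<lambda>f. b * dpow \<alpha> f)" by (simp add: fun_eq_iff quantize_single)
  then show ?case using D_ring_lmult[OF dpow_D_ring] by metis
next
  case (2 a b)
  have "quantize (a + b) = (\<lambda>f. quantize a f + quantize b f)" by (simp add: fun_eq_iff quantize_add)
  then show ?case using D_ring_add[OF 2] by metis
qed

lemma quantize_transpose_D_ring: "quantize_transpose a \<in> D_ring"
proof (induction a rule: poly_mapping_single_induct)
  case (1 \<alpha> b)
  have "quantize_transpose (single \<alpha> b) = (\<lambda>f. index_sign \<alpha> * dpow \<alpha> (b * f))"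
    by (simp add: fun_eq_iff quantize_transpose_single)
  then show ?case using D_ring_lmult[OF D_ring_rmult[OF dpow_D_ring]] by metis
next
  case (2 a b)
  have "quantize_transpose (a + b) = (\<lambda>f. quantize_transpose a f + quantize_transpose b f)"
    by (simp add: fun_eq_iff quantize_transpose_add)
  then show ?case using D_ring_add[OF 2] by metis
qed

section \<open>Existence and uniqueness of normal forms\<close>

lemma mconst_eq_0_iff: "mconst c = 0 \<longleftrightarrow> c = 0"
  by (auto simp: mconst_def dest: arg_cong[of _ _ "\<lambda>f. lookup f 0"])

lemma finite_total_le: "finite {m :: 'n::finite \<Rightarrow>\<^sub>0 nat. total m \<le> N}"
proof (rule inj_on_finite)
  show "inj_on lookup {m :: 'n \<Rightarrow>\<^sub>0 nat. total m \<le> N}"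
    by (auto simp: inj_on_def intro: poly_mapping_eqI)
  have "lookup m j \<le> total m" for m :: "'n \<Rightarrow>\<^sub>0 nat" and j
    unfolding total_def by (rule member_le_sum) auto
  then show "lookup ` {m :: 'n \<Rightarrow>\<^sub>0 nat. total m \<le> N} \<subseteq> UNIV \<rightarrow>\<^sub>E {..N}"
    by (auto simp: PiE_def intro: le_trans)
  show "finite ((UNIV :: 'n set) \<rightarrow>\<^sub>E {..N})" by (rule finite_PiE) auto
qed

text \<open>Unless \<open>m\<close> equals \<alpha>, some exponent of \<open>m\<close> is smaller
  than that of \<alpha>, and differentiation kills it. So iterated derivatives are triangular
  against monomials ordered by degree.\<close>

lemma dpow_monomial_eq_0:
  assumes "total m \<le> total \<alpha>" "m \<noteq> \<alpha>" shows "dpow \<alpha> (single m c) = 0"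
proof -
  have "\<exists>j. lookup m j < lookup \<alpha> j"
  proof (rule ccontr)
    assume "\<not> ?thesis"
    then have le: "\<And>j. lookup \<alpha> j \<le> lookup m j" by (simp add: not_less)
    then have "total \<alpha> = total m" using assms(1) by (intro antisym) (auto simp: total_def intro: sum_mono)
    then have "lookup \<alpha> j = lookup m j" for j
      unfolding total_def by (rule sum_mono_inv) (auto simp: le)
    then show False using assms(2) by (auto intro: poly_mapping_eqI)
  qed
  then obtain j where "lookup m j < lookup \<alpha> j" ..
  then have "(\<Prod>j\<in>UNIV. falling (lookup m j) (lookup \<alpha> j)) = 0"
    by (intro prod_zero) (auto intro: falling_eq_0)
  then show ?thesis by (simp only: dpow_single of_nat_0 mult_zero_left single_zero)
qed

lemma dpow_monomial_self:
  "dpow \<alpha> (single \<alpha> c) = mconst (of_nat (\<Prod>j\<in>UNIV. fact (lookup \<alpha> j)) * c)"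
  by (simp add: dpow_single falling_self mconst_def)

text \<open>At an index \<alpha> of least degree in the support, evaluation at the monomial \<alpha>
  isolates its coefficient times a product of factorials, which characteristic zero keeps
  nonzero.\<close>

lemma quantize_eq_0:
  fixes a :: "('k::field_char_0, 'n::finite) symbol"
  assumes "\<And>f. quantize a f = 0"
  shows "a = 0"
proof (rule ccontr)
  assume "a \<noteq> 0"
  then obtain \<gamma> where "\<gamma> \<in> keys a" by (auto simp: poly_mapping_eq_iff fun_eq_iff in_keys_iff)
  then obtain \<alpha> where \<alpha>: "\<alpha> \<in> keys a" "\<And>\<beta>. \<beta> \<in> keys a \<Longrightarrow> total \<alpha> \<le> total \<beta>"
    using ex_has_least_nat[of "\<lambda>\<alpha>. \<alpha> \<in> keys a" \<gamma> total] by blast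
  have "quantize a (single \<alpha> 1) =
      (\<Sum>\<beta>\<in>keys a. if \<beta> = \<alpha> then lookup a \<alpha> * mconst (of_nat (\<Prod>j\<in>UNIV. fact (lookup \<alpha> j))) else 0)"
    unfolding quantize_def lext_def using \<alpha>(2)
    by (intro sum.cong) (auto simp: dpow_monomial_eq_0 dpow_monomial_self)
  then have "lookup a \<alpha> * mconst (of_nat (\<Prod>j\<in>UNIV. fact (lookup \<alpha> j))) = 0"
    using \<alpha>(1) assms by simp
  moreover have "mconst (of_nat (\<Prod>j\<in>UNIV. fact (lookup \<alpha> j))) \<noteq> (0 :: ('k, 'n) mpoly)"
    by (simp add: mconst_eq_0_iff)
  ultimately have "lookup a \<alpha> = 0" using mpoly_nzd by blast
  then show False using \<alpha>(1) by (simp add: in_keys_iff)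
qed

lemma quantize_inj:
  fixes a b :: "('k::field_char_0, 'n::finite) symbol"
  assumes "quantize a = quantize b"
  shows "a = b"
proof -
  have "quantize (a - b) f = 0" for f
    using quantize_add[of "a - b" b f] assms by simp
  then show ?thesis using quantize_eq_0[of "a - b"] by simp
qed

text \<open>Triangular solving by degree: terms of order \<open>N\<close> correct the values in
  degree \<open>N\<close> and vanish on all monomials of lower degree.\<close>

lemma quantize_interpolate:
  fixes \<xi> :: "('k::field_char_0, 'n::finite) mpoly \<Rightarrow> ('k, 'n) mpoly"
  shows "\<exists>a. quantize a \<in> orderS N \<and>
    (\<forall>m. total m < N \<longrightarrow> quantize a (single m 1) = \<xi> (single m 1))"
proof (induction N)
  case 0
  have "quantize 0 = (\<lambda>f. 0 :: ('k, 'n) mpoly)" by (simp add: fun_eq_iff quantize_zero)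
  then show ?case by (intro exI[of _ 0]) simp
next
  case (Suc N)
  then obtain a where order: "quantize a \<in> orderS N"
    and a: "\<And>m. total m < N \<Longrightarrow> quantize a (single m 1) = \<xi> (single m 1)" by blast
  define F where "F \<alpha> = (of_nat (\<Prod>j\<in>UNIV. fact (lookup \<alpha> j)) :: 'k)" for \<alpha> :: "'n \<Rightarrow>\<^sub>0 nat"
  have F: "F \<alpha> \<noteq> 0" for \<alpha> by (simp add: F_def)
  define A where "A = {m :: 'n \<Rightarrow>\<^sub>0 nat. total m = N}"
  have "finite A" unfolding A_def by (rule finite_subset[OF _ finite_total_le[of N]]) auto
  \<comment> \<open>\<open>dpow \<alpha>\<close> sends its own monomial to the constant
    \<open>F \<alpha>\<close>, so this coefficient makes up exactly for the defect there.\<close>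
  define b where "b \<alpha> = mconst (inverse (F \<alpha>)) * (\<xi> (single \<alpha> 1) - quantize a (single \<alpha> 1))" for \<alpha>
  let ?a = "a + (\<Sum>\<alpha>\<in>A. single \<alpha> (b \<alpha>))"
  have eq: "quantize ?a = (\<lambda>f. quantize a f + (\<Sum>\<alpha>\<in>A. b \<alpha> * dpow \<alpha> f))"
    by (simp add: fun_eq_iff quantize_add quantize_sum quantize_single)
  have "dpow \<alpha> \<in> orderS (Suc N)" if "\<alpha> \<in> A" for \<alpha>
    using dpow_order[of \<alpha>] that by (simp add: A_def del: ord_less.simps)
  then have "quantize ?a \<in> orderS (Suc N)"
    unfolding eq by (intro ord_less_add ord_less_Suc[OF order] ord_less_sum ord_less_lmult)
  moreover have "quantize ?a (single m 1) = \<xi> (single m 1)" if "total m < Suc N" for m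
  proof -
    have "(\<Sum>\<alpha>\<in>A. b \<alpha> * dpow \<alpha> (single m 1)) =
        (\<Sum>\<alpha>\<in>A. if \<alpha> = m then b m * mconst (F m) else 0)"
      using that
      by (intro sum.cong) (auto simp: A_def dpow_monomial_self F_def dpow_monomial_eq_0)
    also have "\<dots> = (if total m = N then b m * mconst (F m) else 0)"
      using \<open>finite A\<close> by (simp add: A_def)
    also have "b m * mconst (F m) =
        mconst (inverse (F m) * F m) * (\<xi> (single m 1) - quantize a (single m 1))"
      unfolding b_def mconst_mult by (simp add: ac_simps)
    finally show ?thesis
      using that a[of m] F[of m] by (auto simp: eq)
  qed
  ultimately show ?case by blast
qed

text \<open>The commutator with a variable has lower order and vanishes on monomials of one degree
  less, so it is zero by induction. Then \<xi> commutes with all multiplications, and its value at 1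
  is zero.\<close>

lemma diff_op_determined:
  fixes \<xi> :: "('k::field, 'n::finite) mpoly \<Rightarrow> ('k, 'n) mpoly"
  assumes "\<xi> \<in> orderS n" and "\<And>m. total m < n \<Longrightarrow> \<xi> (single m 1) = 0"
  shows "\<xi> = (\<lambda>_. 0)"
  using assms
proof (induction n arbitrary: \<xi>)
  case 0
  then show ?case by simp
next
  case (Suc n)
  note \<xi> = ord_less_alg_End[OF Suc.prems(1)]
  have var: "\<xi> (mvar i * g) = mvar i * \<xi> g" for i g
  proof -
    have "ad \<xi> (mvar i) = (\<lambda>_. 0)"
    proof (rule Suc.IH)
      show "ad \<xi> (mvar i) \<in> orderS n" using Suc.prems(1) by (rule ord_less_SucD) simp
      fix m :: "'n \<Rightarrow>\<^sub>0 nat" assume m: "total m < n"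
      have "total (single i 1 + m) = Suc (total m)"
        using total_step[of m i] by (simp add: add.commute)
      then show "ad \<xi> (mvar i) (single m 1) = 0"
        using m Suc.prems(2)[of m] Suc.prems(2)[of "single i 1 + m"]
        by (simp add: ad_apply mvar_def mult_single)
    qed
    then show ?thesis by (metis ad_apply eq_iff_diff_eq_0)
  qed
  have mult: "\<xi> (f * g) = f * \<xi> g" for f g
    by (induction f arbitrary: g rule: mpoly_induct)
      (simp_all add: var alg_End_UNIV_scale[OF \<xi>] alg_End_UNIV_add[OF \<xi>] distrib_right mult.assoc)
  have "\<xi> 1 = 0"
    using Suc.prems(2)[of 0] by (simp add: total_def)
  then have "\<xi> f = 0" for f using mult[of f 1] by simp
  then show ?case by blast
qed

text \<open>An operator and its interpolant have the same order bound and agree on the monomials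
  that determine operators of that order.\<close>

lemma D_ring_eq_range_quantize:
  "(D_ring :: (('k::field_char_0, 'n::finite) mpoly \<Rightarrow> _) set) = range quantize"
proof (intro equalityI subsetI)
  fix \<xi> :: "('k, 'n) mpoly \<Rightarrow> ('k, 'n) mpoly" assume "\<xi> \<in> D_ring"
  then obtain n where n: "\<xi> \<in> orderS n" unfolding carrier_diff_op_ring_UNIV by blast
  obtain a where a: "quantize a \<in> orderS n"
    "\<And>m. total m < n \<Longrightarrow> quantize a (single m 1) = \<xi> (single m 1)"
    using quantize_interpolate[of n \<xi>] by blast
  have "(\<lambda>f. \<xi> f - quantize a f) \<in> orderS n" by (intro ord_less_diff n a(1))
  from diff_op_determined[OF this] a(2) have "(\<lambda>f. \<xi> f - quantize a f) = (\<lambda>_. 0)" by simp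
  then have "\<xi> = quantize a" by (simp add: fun_eq_iff)
  then show "\<xi> \<in> range quantize" by blast
qed (use quantize_D_ring in auto)

section \<open>The standard transposition\<close>

lemma mult_diff_op_ring_UNIV: "\<xi> \<otimes>\<^bsub>diff_op_ring \<iota> UNIV\<^esub> \<eta> = \<xi> \<circ> \<eta>"
  by (simp add: diff_op_ring_def compose_def fun_eq_iff)

lemma add_diff_op_ring_UNIV: "\<xi> \<oplus>\<^bsub>diff_op_ring \<iota> UNIV\<^esub> \<eta> = (\<lambda>f. \<xi> f + \<eta> f)"
  by (simp add: diff_op_ring_def fun_eq_iff)

lemma one_diff_op_ring_UNIV: "\<one>\<^bsub>diff_op_ring \<iota> UNIV\<^esub> = (\<lambda>f. f)"
  by (simp add: diff_op_ring_def fun_eq_iff)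

lemma D_ring_symbol_induct [consumes 1, case_names monomial add]:
  fixes \<xi> :: "('k::field_char_0, 'n::finite) mpoly \<Rightarrow> ('k, 'n) mpoly"
  assumes "\<xi> \<in> D_ring"
    and monomial: "\<And>b \<alpha>. P (\<lambda>f. b * dpow \<alpha> f)"
    and add: "\<And>\<xi> \<eta>. \<xi> \<in> D_ring \<Longrightarrow> \<eta> \<in> D_ring \<Longrightarrow> P \<xi> \<Longrightarrow> P \<eta> \<Longrightarrow> P (\<lambda>f. \<xi> f + \<eta> f)"
  shows "P \<xi>"
proof -
  have "P (quantize a)" for a
  proof (induction a rule: poly_mapping_single_induct)
    case (1 \<alpha> b)
    have "quantize (single \<alpha> b) = (\<lambda>f. b * dpow \<alpha> f)" by (simp add: fun_eq_iff quantize_single)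
    then show ?case using monomial by simp
  next
    case (2 a b)
    have "quantize (a + b) = (\<lambda>f. quantize a f + quantize b f)" by (simp add: fun_eq_iff quantize_add)
    then show ?case using add[OF quantize_D_ring quantize_D_ring 2] by simp
  qed
  then show ?thesis using assms(1) unfolding D_ring_eq_range_quantize by blast
qed

text \<open>Normal forms arise from the identity by composing on the left with multiplications and
  derivatives, so identities can be checked one generator at a time.\<close>

lemma D_ring_induct [consumes 1, case_names id mult deriv add]:
  fixes \<xi> :: "('k::field_char_0, 'n::finite) mpoly \<Rightarrow> ('k, 'n) mpoly"
  assumes "\<xi> \<in> D_ring"
    and id: "P (\<lambda>f. f)"
    and mult: "\<And>b \<xi>. \<xi> \<in> D_ring \<Longrightarrow> P \<xi> \<Longrightarrow> P (\<lambda>f. b * \<xi> f)"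
    and deriv: "\<And>i \<xi>. \<xi> \<in> D_ring \<Longrightarrow> P \<xi> \<Longrightarrow> P (\<lambda>f. mpderiv i (\<xi> f))"
    and add: "\<And>\<xi> \<eta>. \<xi> \<in> D_ring \<Longrightarrow> \<eta> \<in> D_ring \<Longrightarrow> P \<xi> \<Longrightarrow> P \<eta> \<Longrightarrow> P (\<lambda>f. \<xi> f + \<eta> f)"
  shows "P \<xi>"
  using assms(1)
proof (induction \<xi> rule: D_ring_symbol_induct)
  case (monomial b \<alpha>)
  have "P (dpow \<alpha>)"
  proof (induction \<alpha> rule: index_induct)
    case zero
    have "dpow 0 = (\<lambda>f. f :: ('k, 'n) mpoly)" by (simp add: fun_eq_iff dpow_zero_index)
    with id show ?case by simp
  next
    case (step \<alpha> i)
    have "dpow (\<alpha> + single i 1) = (\<lambda>f. mpderiv i (dpow \<alpha> f) :: ('k, 'n) mpoly)"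
      by (simp add: fun_eq_iff mpderiv_dpow)
    with deriv[OF dpow_D_ring step] show ?case by simp
  qed
  then show ?case by (rule mult[OF dpow_D_ring])
qed (rule add)

text \<open>Restricted to \<open>D_ring\<close> because \<open>is_standard_transposition\<close>
  demands extensionality; the symbol is unique by \<open>quantize_inj\<close>.\<close>

definition transposition ::
    "(('k::field_char_0, 'n::finite) mpoly \<Rightarrow> ('k, 'n) mpoly) \<Rightarrow> ('k, 'n) mpoly \<Rightarrow> ('k, 'n) mpoly"
  where "transposition = (\<lambda>\<xi>\<in>D_ring. quantize_transpose (THE a. quantize a = \<xi>))"

lemma transposition_quantize: "transposition (quantize a) = quantize_transpose a"
proof -
  have "(THE b. quantize b = quantize a) = a" using quantize_inj by blast
  then show ?thesis by (simp add: transposition_def quantize_D_ring)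
qed

lemma transposition_monomial:
  "transposition (\<lambda>f. b * dpow \<alpha> f) = (\<lambda>f. index_sign \<alpha> * dpow \<alpha> (b * f))"
proof -
  have "(\<lambda>f. b * dpow \<alpha> f) = quantize (single \<alpha> b)" by (simp add: fun_eq_iff quantize_single)
  then show ?thesis by (simp add: transposition_quantize fun_eq_iff quantize_transpose_single)
qed

lemma transposition_D_ring: "\<xi> \<in> D_ring \<Longrightarrow> transposition \<xi> \<in> D_ring"
proof -
  assume "\<xi> \<in> D_ring"
  then obtain a where "\<xi> = quantize a" unfolding D_ring_eq_range_quantize by blast
  then show ?thesis by (simp only: transposition_quantize quantize_transpose_D_ring)
qed

lemma transposition_add:
  assumes "\<xi> \<in> D_ring" "\<eta> \<in> D_ring"
  shows "transposition (\<lambda>f. \<xi> f + \<eta> f) = (\<lambda>f. transposition \<xi> f + transposition \<eta> f)"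
proof -
  obtain a b where "\<xi> = quantize a" "\<eta> = quantize b"
    using assms unfolding D_ring_eq_range_quantize by blast
  moreover have "(\<lambda>f. quantize a f + quantize b f) = quantize (a + b)"
    by (simp add: fun_eq_iff quantize_add)
  ultimately show ?thesis
    by (simp only: transposition_quantize) (simp add: fun_eq_iff quantize_transpose_add)
qed

lemma transposition_sum:
  assumes "finite X" "\<And>x. x \<in> X \<Longrightarrow> \<xi> x \<in> D_ring"
  shows "transposition (\<lambda>f. \<Sum>x\<in>X. \<xi> x f) = (\<lambda>f. \<Sum>x\<in>X. transposition (\<xi> x) f)
    \<and> (\<lambda>f. \<Sum>x\<in>X. \<xi> x f) \<in> D_ring"
  using assms
proof (induction X rule: finite_induct)
  case empty
  show ?case using transposition_monomial[of 0 0] by (simp add: D_ring_zero)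
next
  case (insert x X)
  then show ?case by (simp add: transposition_add D_ring_add)
qed

lemma transposition_lmult:
  "\<xi> \<in> D_ring \<Longrightarrow> transposition (\<lambda>f. b * \<xi> f) = (\<lambda>f. transposition \<xi> (b * f))"
proof (induction \<xi> rule: D_ring_symbol_induct)
  case (monomial b' \<alpha>)
  have "(\<lambda>f. b * (b' * dpow \<alpha> f)) = (\<lambda>f. (b' * b) * dpow \<alpha> f)" by (simp add: ac_simps)
  then show ?case by (simp only: transposition_monomial) (simp add: mult.assoc)
next
  case (add \<xi> \<eta>)
  then show ?case by (simp add: distrib_left transposition_add D_ring_lmult)
qed

lemma transposition_id: "transposition (\<lambda>f. f) = (\<lambda>f. f)"
  using transposition_monomial[of 1 0] by (simp add: dpow_zero_index index_sign_0)

lemma transposition_mult: "transposition (\<lambda>f. b * f) = (\<lambda>f. b * f)"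
  using transposition_lmult[OF id_D_ring, of b] by (simp add: transposition_id)

lemma mpderiv_comp_D_ring: "\<xi> \<in> D_ring \<Longrightarrow> (\<lambda>f. mpderiv i (\<xi> f)) \<in> D_ring"
  using D_ring_comp[OF mpderiv_D_ring[of i]] by (simp add: comp_def)

text \<open>The product rule puts the composite into normal form; after transposing, the same rule
  applied to \<open>b * f\<close> recombines the two terms.\<close>

lemma transposition_deriv_comp:
  "\<xi> \<in> D_ring \<Longrightarrow>
    transposition (\<lambda>f. mpderiv i (\<xi> f)) = (\<lambda>f. - transposition \<xi> (mpderiv i f))"
proof (induction \<xi> rule: D_ring_symbol_induct)
  case (monomial b \<alpha>)
  have "(\<lambda>f. mpderiv i (b * dpow \<alpha> f)) =
      (\<lambda>f. mpderiv i b * dpow \<alpha> f + b * dpow (\<alpha> + single i 1) f)"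
    by (simp add: fun_eq_iff mpderiv_mult mpderiv_dpow)
  then have "transposition (\<lambda>f. mpderiv i (b * dpow \<alpha> f)) =
      (\<lambda>f. index_sign \<alpha> * dpow \<alpha> (mpderiv i b * f)
        - index_sign \<alpha> * dpow \<alpha> (mpderiv i (b * f)))"
    by (simp add: transposition_add D_ring_lmult dpow_D_ring transposition_monomial
        dpow_mpderiv index_sign_Suc[simplified])
  also have "\<dots> = (\<lambda>f. - (index_sign \<alpha> * dpow \<alpha> (b * mpderiv i f)))"
    by (simp add: fun_eq_iff mpderiv_mult dpow_add distrib_left)
  finally show ?case by (simp only: transposition_monomial)
next
  case (add \<xi> \<eta>)
  then show ?case by (simp add: mpderiv_add transposition_add mpderiv_comp_D_ring)
qed

lemma transposition_deriv: "transposition (mpderiv i) = (\<lambda>f. - mpderiv i f)"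
  using transposition_deriv_comp[OF id_D_ring, of i] by (simp add: transposition_id)

text \<open>Induction on the left factor alone suffices: its generator steps are
  \<open>transposition_lmult\<close> and \<open>transposition_deriv_comp\<close>, which hold for an
  arbitrary operator on the right.\<close>

lemma transposition_comp:
  assumes "\<xi> \<in> D_ring" "\<eta> \<in> D_ring"
  shows "transposition (\<lambda>f. \<xi> (\<eta> f)) = (\<lambda>f. transposition \<eta> (transposition \<xi> f))"
proof -
  note \<eta> = D_ring_alg_End[OF transposition_D_ring[OF assms(2)]]
  have comp: "(\<lambda>f. \<zeta> (\<eta> f)) \<in> D_ring" if "\<zeta> \<in> D_ring" for \<zeta>
    using D_ring_comp[OF that assms(2)] by (simp add: comp_def)
  show ?thesis
    using assms(1)
  proof (induction \<xi> rule: D_ring_induct)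
    case id
    show ?case by (simp add: transposition_id)
  next
    case (mult b \<xi>)
    then show ?case by (simp add: transposition_lmult[OF comp] transposition_lmult)
  next
    case (deriv i \<xi>)
    then show ?case
      by (simp add: transposition_deriv_comp[OF comp] transposition_deriv_comp alg_End_UNIV_minus[OF \<eta>])
  next
    case (add \<xi> \<xi>')
    then show ?case
      by (simp add: transposition_add comp alg_End_UNIV_add[OF \<eta>])
  qed
qed

lemma transposition_involutive:
  fixes \<xi> :: "('k::field_char_0, 'n::finite) mpoly \<Rightarrow> ('k, 'n) mpoly"
  assumes "\<xi> \<in> D_ring"
  shows "transposition (transposition \<xi>) = \<xi>"
  using assms
proof (induction \<xi> rule: D_ring_induct)
  case id
  show ?case by (simp add: transposition_id)
next
  case (mult b \<xi>)
  then show ?case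
    by (simp add: transposition_lmult transposition_comp[OF transposition_D_ring mult_D_ring]
        transposition_mult)
next
  case (deriv i \<xi>)
  \<comment> \<open>Written as multiplication by -1, the sign falls under the rule for left
    multiplication.\<close>
  have minus: "(\<lambda>f. - mpderiv i f) = (\<lambda>f :: ('k, 'n) mpoly. (- 1) * mpderiv i f)" by simp
  have D: "(\<lambda>f :: ('k, 'n) mpoly. - mpderiv i f) \<in> D_ring"
    unfolding minus by (rule D_ring_lmult[OF mpderiv_D_ring])
  have T: "transposition (\<lambda>f :: ('k, 'n) mpoly. - mpderiv i f) = mpderiv i"
    unfolding minus transposition_lmult[OF mpderiv_D_ring]
    by (simp add: transposition_deriv alg_End_UNIV_minus[OF D_ring_alg_End[OF mpderiv_D_ring]])
  have "(\<lambda>f. - transposition \<xi> (mpderiv i f)) = (\<lambda>f. transposition \<xi> (- mpderiv i f))"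
    by (simp add: alg_End_UNIV_minus[OF D_ring_alg_End[OF transposition_D_ring[OF deriv.hyps]]])
  then show ?case
    using deriv by (simp add: transposition_deriv_comp T
        transposition_comp[OF transposition_D_ring[OF deriv.hyps] D])
next
  case (add \<xi> \<eta>)
  then show ?case by (simp add: transposition_add transposition_D_ring)
qed

lemma is_standard_transposition_transposition:
  "is_standard_transposition
    (transposition :: (('k::field_char_0, 'n::finite) mpoly \<Rightarrow> _) \<Rightarrow> _)"
proof -
  have "bij_betw transposition D_ring (D_ring :: (('k, 'n) mpoly \<Rightarrow> _) set)"
    by (rule bij_betwI[where g = transposition]) (auto simp: transposition_D_ring transposition_involutive)
  moreover have "transposition (\<lambda>g. mconst c * \<xi> g) = (\<lambda>g. mconst c * transposition \<xi> g)"
    if "\<xi> \<in> D_ring" for c and \<xi> :: "('k, 'n) mpoly \<Rightarrow> ('k, 'n) mpoly"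
    unfolding transposition_lmult[OF that]
    by (simp add: alg_End_UNIV_scale[OF D_ring_alg_End[OF transposition_D_ring[OF that]]])
  ultimately show ?thesis
    unfolding is_standard_transposition_def ring_anti_automorphism_def mult_diff_op_ring_UNIV
      add_diff_op_ring_UNIV one_diff_op_ring_UNIV mult_op_UNIV comp_def
    by (simp add: transposition_add transposition_comp transposition_id transposition_mult
        transposition_deriv) (simp add: transposition_def)
qed

text \<open>Scalars, variables and compatibility with sums and products fix \<tau> on all
  multiplications; together with the derivatives these generate, and extensionality settles the
  rest. This evaluates the \<open>THE\<close> in \<open>standard_transposition\<close>.\<close>

lemma is_standard_transposition_unique:
  assumes "is_standard_transposition \<tau>"
  shows "\<tau> = transposition"
proof -
  have ext: "\<tau> \<in> extensional D_ring"
    and \<tau>_add: "\<And>\<xi> \<eta>. \<xi> \<in> D_ring \<Longrightarrow> \<eta> \<in> D_ring \<Longrightarrow> \<tau> (\<lambda>f. \<xi> f + \<eta> f) = (\<lambda>f. \<tau> \<xi> f + \<tau> \<eta> f)"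
    and \<tau>_id: "\<tau> (\<lambda>f. f) = (\<lambda>f. f)"
    and \<tau>_comp: "\<And>\<xi> \<eta>. \<xi> \<in> D_ring \<Longrightarrow> \<eta> \<in> D_ring \<Longrightarrow> \<tau> (\<lambda>f. \<xi> (\<eta> f)) = (\<lambda>f. \<tau> \<eta> (\<tau> \<xi> f))"
    and \<tau>_scale: "\<And>c \<xi>. \<xi> \<in> D_ring \<Longrightarrow> \<tau> (\<lambda>g. mconst c * \<xi> g) = (\<lambda>g. mconst c * \<tau> \<xi> g)"
    and \<tau>_var: "\<And>i. \<tau> (\<lambda>f. mvar i * f) = (\<lambda>f. mvar i * f)"
    and \<tau>_deriv: "\<And>i. \<tau> (mpderiv i) = (\<lambda>g. - mpderiv i g)"
    using assms
    unfolding is_standard_transposition_def ring_anti_automorphism_def mult_diff_op_ring_UNIV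
      add_diff_op_ring_UNIV one_diff_op_ring_UNIV mult_op_UNIV comp_def
    by blast+
  have \<tau>_mult: "\<tau> (\<lambda>f. b * f) = (\<lambda>f. b * f)" for b
  proof (induction b rule: mpoly_induct)
    case (const c)
    show ?case using \<tau>_scale[OF id_D_ring, of c] by (simp add: \<tau>_id)
  next
    case (var i)
    show ?case by (rule \<tau>_var)
  next
    case (add f g)
    then show ?case
      using \<tau>_add[OF mult_D_ring mult_D_ring, of f g]
      by (simp add: distrib_right)
  next
    case (mult f g)
    then show ?case
      using \<tau>_comp[OF mult_D_ring mult_D_ring, of f g] by (simp add: mult.assoc mult.left_commute)
  qed
  have "\<tau> \<xi> = transposition \<xi>" if "\<xi> \<in> D_ring" for \<xi>
    using that
  proof (induction \<xi> rule: D_ring_induct)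
    case id
    show ?case by (simp add: \<tau>_id transposition_id)
  next
    case (mult b \<xi>)
    then show ?case
      using \<tau>_comp[OF mult_D_ring mult.hyps, of b] by (simp add: \<tau>_mult transposition_lmult)
  next
    case (deriv i \<xi>)
    have "transposition \<xi> (- f) = - transposition \<xi> f" for f
      by (rule alg_End_UNIV_minus[OF D_ring_alg_End[OF transposition_D_ring[OF deriv.hyps]]])
    with deriv show ?case
      using \<tau>_comp[OF mpderiv_D_ring deriv.hyps, of i]
      by (simp add: \<tau>_deriv transposition_deriv_comp)
  next
    case (add \<xi> \<eta>)
    then show ?case by (simp add: \<tau>_add transposition_add)
  qed
  then show ?thesis
    using ext by (intro extensionalityI[of _ D_ring]) (auto simp: transposition_def)
qed

lemma standard_transposition_eq: "standard_transposition = transposition"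
  unfolding standard_transposition_def
  using is_standard_transposition_transposition is_standard_transposition_unique
  by (rule the_equality)

section \<open>Equivariance\<close>

text \<open>The inverse is a separate argument, so that only matrix identities between
  \<open>A\<close> and \<open>B\<close> are used and no inverse in \<open>GL\<close> is
  computed.\<close>

definition conj_op :: "'k::field ^ 'n ^ 'n \<Rightarrow> 'k ^ 'n ^ 'n \<Rightarrow>
    (('k, 'n::finite) mpoly \<Rightarrow> ('k, 'n) mpoly) \<Rightarrow> ('k, 'n) mpoly \<Rightarrow> ('k, 'n) mpoly" where
  "conj_op A B \<xi> f = lin_act A (\<xi> (lin_act B f))"

lemma conj_op_order:
  assumes "A ** B = mat 1" "\<xi> \<in> orderS n" shows "conj_op A B \<xi> \<in> orderS n"
  using assms(2)
proof (induction n arbitrary: \<xi>)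
  case 0
  then show ?case by (simp add: fun_eq_iff conj_op_def)
next
  case (Suc n)
  note \<xi> = ord_less_alg_End[OF Suc.prems]
  have "ad (conj_op A B \<xi>) f = conj_op A B (ad \<xi> (lin_act B f))" for f
    using lin_act_add[of A] lin_act_minus[of A]
    by (simp add: fun_eq_iff ad_apply conj_op_def lin_act_mult lin_act_compose assms(1) lin_act_mat_1
        diff_conv_add_uminus del: add_uminus_conv_diff)
  moreover have "conj_op A B \<xi> \<in> alg_End mconst UNIV"
    by (simp add: alg_End_UNIV_iff conj_op_def lin_act_add lin_act_mult alg_End_UNIV_add[OF \<xi>]
        alg_End_UNIV_scale[OF \<xi>])
  ultimately show ?case using Suc by simp
qed

lemma conj_op_D_ring: "A ** B = mat 1 \<Longrightarrow> \<xi> \<in> D_ring \<Longrightarrow> conj_op A B \<xi> \<in> D_ring"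
  unfolding carrier_diff_op_ring_UNIV by (blast intro: conj_op_order)

lemma mpderiv_linform:
  fixes v :: "'k::field ^ 'n::finite"
  shows "mpderiv i (linform v) = mconst (v $ i)"
proof -
  have "mpderiv i (\<Sum>j\<in>X. h j) = (\<Sum>j\<in>X. mpderiv i (h j))" for X and h :: "'n \<Rightarrow> ('k, 'n) mpoly"
    by (rule alg_End_UNIV_sum[OF D_ring_alg_End[OF mpderiv_D_ring]])
  then show ?thesis
    by (simp add: linform_def mpderiv_mult mpderiv_mvar if_distrib[of "(*) _"] cong: if_cong)
qed

text \<open>A conjugated derivative is again a derivation, and its values on the variables are the
  constants in row \<open>i\<close> of \<open>B\<close>.\<close>

lemma conj_op_mpderiv:
  assumes "A ** B = mat 1"
  shows "conj_op A B (mpderiv i) f = (\<Sum>j\<in>UNIV. mconst (B $ i $ j) * mpderiv j f)"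
proof -
  have AB: "lin_act A (lin_act B f) = f" for f
    by (simp add: lin_act_compose assms lin_act_mat_1)
  have "conj_op A B (mpderiv i) f = (\<Sum>j\<in>UNIV. conj_op A B (mpderiv i) (mvar j) * mpderiv j f)"
    by (rule derivation_eq_sum)
      (simp_all add: conj_op_def lin_act_add lin_act_mult mpderiv_add mpderiv_mult AB)
  then show ?thesis by (simp add: conj_op_def lin_act_mvar mpderiv_linform column_def)
qed

text \<open>Conjugation turns multiplication by \<open>b\<close> into multiplication by
  \<open>lin_act A b\<close>, and a derivative into a constant combination of derivatives. The
  former are fixed by the transposition, the latter change sign.\<close>

lemma transposition_conj_op:
  fixes \<xi> :: "('k::field_char_0, 'n::finite) mpoly \<Rightarrow> ('k, 'n) mpoly"
  assumes AB: "A ** B = mat 1" and BA: "B ** A = mat 1" and "\<xi> \<in> D_ring"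
  shows "transposition (conj_op A B \<xi>) = conj_op A B (transposition \<xi>)"
proof -
  have AB': "lin_act A (lin_act B f) = f" and BA': "lin_act B (lin_act A f) = f"
    for f :: "('k, 'n) mpoly"
    by (simp_all add: lin_act_compose AB BA lin_act_mat_1)
  show ?thesis
    using assms(3)
  proof (induction \<xi> rule: D_ring_induct)
    case id
    have "conj_op A B (\<lambda>f. f) = (\<lambda>f. f)" by (simp add: fun_eq_iff conj_op_def AB')
    then show ?case by (simp add: transposition_id)
  next
    case (mult b \<xi>)
    have "conj_op A B (\<lambda>f. b * \<xi> f) = (\<lambda>f. lin_act A b * conj_op A B \<xi> f)"
      by (simp add: fun_eq_iff conj_op_def lin_act_mult)
    then show ?case
      using mult
      by (simp add: transposition_lmult conj_op_D_ring[OF AB])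
        (simp add: fun_eq_iff conj_op_def lin_act_mult BA')
  next
    case (deriv i \<xi>)
    let ?\<eta> = "conj_op A B \<xi>"
    have \<eta>: "?\<eta> \<in> D_ring" by (rule conj_op_D_ring[OF AB deriv.hyps])
    note T\<eta> = D_ring_alg_End[OF transposition_D_ring[OF \<eta>]]
    have "conj_op A B (\<lambda>f. mpderiv i (\<xi> f)) f = conj_op A B (mpderiv i) (?\<eta> f)" for f
      by (simp add: conj_op_def BA')
    then have "conj_op A B (\<lambda>f. mpderiv i (\<xi> f)) =
        (\<lambda>f. \<Sum>j\<in>UNIV. mconst (B $ i $ j) * mpderiv j (?\<eta> f))"
      by (simp add: fun_eq_iff conj_op_mpderiv[OF AB])
    then have "transposition (conj_op A B (\<lambda>f. mpderiv i (\<xi> f))) =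
        (\<lambda>f. \<Sum>j\<in>UNIV. transposition (\<lambda>f. mconst (B $ i $ j) * mpderiv j (?\<eta> f)) f)"
      using transposition_sum[of UNIV "\<lambda>j f. mconst (B $ i $ j) * mpderiv j (?\<eta> f)"]
      by (simp add: D_ring_lmult mpderiv_comp_D_ring \<eta>)
    \<comment> \<open>Transposing puts the coefficient inside the derivative; being constant, it
      comes out again.\<close>
    also have "\<dots> = (\<lambda>f. \<Sum>j\<in>UNIV. - transposition ?\<eta> (mconst (B $ i $ j) * mpderiv j f))"
      by (simp add: transposition_lmult mpderiv_comp_D_ring transposition_deriv_comp \<eta> mpderiv_mconst_mult)
    also have "\<dots> = (\<lambda>f. - transposition ?\<eta> (conj_op A B (mpderiv i) f))"
      by (simp add: fun_eq_iff conj_op_mpderiv[OF AB] alg_End_UNIV_sum[OF T\<eta>] sum_negf)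
    also have "\<dots> = conj_op A B (transposition (\<lambda>f. mpderiv i (\<xi> f)))"
      unfolding deriv.IH transposition_deriv_comp[OF deriv.hyps]
      by (simp add: fun_eq_iff conj_op_def BA' lin_act_minus)
    finally show ?case .
  next
    case (add \<xi> \<eta>)
    have "conj_op A B (\<lambda>f. \<xi> f + \<eta> f) = (\<lambda>f. conj_op A B \<xi> f + conj_op A B \<eta> f)"
      by (simp add: fun_eq_iff conj_op_def lin_act_add)
    then show ?case
      using add by (simp add: transposition_add conj_op_D_ring[OF AB])
        (simp add: fun_eq_iff conj_op_def lin_act_add)
  qed
qed

section \<open>Kantor's isomorphism\<close>

lemma group_GL: "group (GL :: ('k::field ^ 'n ^ 'n::finite) monoid)"
proof (rule groupI)
  fix A :: "'k ^ 'n ^ 'n" assume "A \<in> carrier GL"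
  then obtain B where "A ** B = mat 1" "B ** A = mat 1" by (auto simp: GL_def invertible_def)
  then show "\<exists>B\<in>carrier GL. B \<otimes>\<^bsub>GL\<^esub> A = \<one>\<^bsub>GL\<^esub>"
    by (auto simp: GL_def invertible_def)
next
  show "\<one>\<^bsub>GL\<^esub> \<in> carrier (GL :: ('k ^ 'n ^ 'n) monoid)"
    by (auto simp: GL_def invertible_def intro: exI[of _ "mat 1"])
qed (auto simp: GL_def invertible_mult matrix_mul_assoc)

lemma lin_act_inj: "lin_act A = lin_act B \<Longrightarrow> A = B"
proof -
  assume eq: "lin_act A = lin_act B"
  have "column j A = column j B" for j
    using fun_cong[OF eq, of "mvar j"] linform_diff[of "column j A" "column j B"]
    by (simp add: lin_act_mvar linform_eq_0_iff)
  then show ?thesis by (simp add: vec_eq_iff column_def)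
qed

lemma lin_act_eq_id:
  fixes A :: "'k::field ^ 'n ^ 'n::finite"
  shows "lin_act A = id \<longleftrightarrow> A = mat 1"
proof -
  have "lin_act (mat 1) = (id :: ('k, 'n) mpoly \<Rightarrow> _)" by (simp add: fun_eq_iff lin_act_mat_1)
  then show ?thesis using lin_act_inj by metis
qed

section \<open>Groups without pseudoreflections and coprime denominators\<close>

locale reflection_free =
  fixes G :: "('k::field_char_0 ^ 'n ^ 'n::finite) set"
  assumes subgroup: "subgroup G GL" and finite_G: "finite G"
    and no_pseudoreflection: "\<And>\<gamma>. \<gamma> \<in> G \<Longrightarrow> \<not> pseudoreflection \<gamma>"
begin

lemma mat_1_mem: "mat 1 \<in> G"
  using subgroup.one_closed[OF subgroup] by (simp add: GL_def)

lemma mult_mem: "A \<in> G \<Longrightarrow> B \<in> G \<Longrightarrow> A ** B \<in> G"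
  using subgroup.m_closed[OF subgroup] by (simp add: GL_def)

lemma invertible: "A \<in> G \<Longrightarrow> invertible A"
  using subgroup.mem_carrier[OF subgroup] by (simp add: GL_def)

lemma inv_mem: "A \<in> G \<Longrightarrow> inv\<^bsub>GL\<^esub> A \<in> G"
  by (rule subgroup.m_inv_closed[OF subgroup])

lemma inv_mult: "A \<in> G \<Longrightarrow> inv\<^bsub>GL\<^esub> A ** A = mat 1" "A \<in> G \<Longrightarrow> A ** inv\<^bsub>GL\<^esub> A = mat 1"
  using group.l_inv[OF group_GL, of A] group.r_inv[OF group_GL, of A]
    subgroup.mem_carrier[OF subgroup, of A] by (simp_all add: GL_def)

sublocale finite_aut mconst "lin_act ` G"
proof
  show "x = 0 \<or> y = 0" if "x * y = 0" for x y :: "('k, 'n) mpoly" by (rule mpoly_nzd[OF that])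
  show "finite (lin_act ` G)" using finite_G by simp
  show "id \<in> lin_act ` G" using mat_1_mem lin_act_eq_id[of "mat 1"] by (metis imageI)
  show "\<sigma> \<circ> \<tau> \<in> lin_act ` G" if "\<sigma> \<in> lin_act ` G" "\<tau> \<in> lin_act ` G" for \<sigma> \<tau>
    using that mult_mem by (force simp: fun_eq_iff lin_act_compose)
  show "inj \<sigma>" if \<sigma>: "\<sigma> \<in> lin_act ` G" for \<sigma>
  proof -
    obtain A where A: "A \<in> G" "\<sigma> = lin_act A" using \<sigma> by blast
    show ?thesis
      by (rule inj_on_inverseI[of _ "lin_act (inv\<^bsub>GL\<^esub> A)"])
        (simp add: A lin_act_compose inv_mult lin_act_mat_1)
  qed
qed (auto simp: lin_act_add lin_act_mult)

lemma R_eq: "R = invariant_ring G"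
  by (auto simp: R_def invariant_ring_def)

text \<open>The fixed spaces of the elements other than 1 are finitely many proper subspaces. A
  vector outside them yields a linear form with nonzero \<open>disc\<close>.\<close>

lemma exists_generic_vector: "\<exists>v. \<forall>A\<in>G-{mat 1}. A *v v \<noteq> v"
proof -
  have "\<exists>v. \<forall>U\<in>(\<lambda>A. {v. A *v v = v}) ` (G - {mat 1}). v \<notin> U"
  proof (rule exists_avoiding_subspaces)
    fix U assume "U \<in> (\<lambda>A. {v. A *v v = v}) ` (G - {mat 1})"
    then obtain A where A: "A \<noteq> mat 1" "U = {v. A *v v = v}" by blast
    have "vec.subspace U" unfolding A
      by (rule vec.subspaceI) (auto simp: matrix_vector_right_distrib vector_scalar_commute)
    moreover obtain e where "A *v e \<noteq> e" using A(1) by (metis matrix_eq matrix_vector_mul_lid)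
    ultimately show "vec.subspace U \<and> U \<noteq> UNIV" using A(2) by blast
  qed (use finite_G in simp)
  then show ?thesis by auto
qed

text \<open>With \<open>v\<close> fixed, \<open>w\<close> has to avoid the subspaces where (A - 1) w
  lies on the line through (B - 1) v. They are proper because A - 1 has rank at least two: here the
  absence of pseudoreflections enters.\<close>

lemma exists_generic_pair:
  "\<exists>v w. (\<forall>A\<in>G-{mat 1}. A *v v \<noteq> v) \<and>
    (\<forall>A\<in>G-{mat 1}. \<forall>B\<in>G-{mat 1}. \<forall>c. A *v w - w \<noteq> c *s (B *v v - v))"
proof -
  obtain v where v: "\<forall>A\<in>G-{mat 1}. A *v v \<noteq> v" using exists_generic_vector by blast
  define U where "U = (\<lambda>(A, B). {w. \<exists>c. A *v w - w = c *s (B *v v - v)})"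
  have "\<exists>w. \<forall>V\<in>U ` ((G - {mat 1}) \<times> (G - {mat 1})). w \<notin> V"
  proof (rule exists_avoiding_subspaces)
    fix V assume "V \<in> U ` ((G - {mat 1}) \<times> (G - {mat 1}))"
    then obtain A u where A: "A \<in> G" "A \<noteq> mat 1" and V: "V = {w. \<exists>c. A *v w - w = c *s u}"
      by (auto simp: U_def)
    have "vec.subspace V"
    proof (rule vec.subspaceI)
      show "0 \<in> V" unfolding V by (auto intro: exI[of _ 0])
    next
      fix x y assume "x \<in> V" "y \<in> V"
      then obtain c d where "A *v x - x = c *s u" "A *v y - y = d *s u" unfolding V by blast
      moreover have "A *v (x + y) - (x + y) = (A *v x - x) + (A *v y - y)"
        by (simp add: matrix_vector_right_distrib)
      ultimately have "A *v (x + y) - (x + y) = (c + d) *s u"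
        by (simp only: vec.scale_left_distrib)
      then show "x + y \<in> V" unfolding V by blast
    next
      fix c x assume "x \<in> V"
      then obtain d where "A *v x - x = d *s u" unfolding V by blast
      then have "A *v (c *s x) - c *s x = (c * d) *s u"
        by (simp only: vector_scalar_commute vec.scale_right_diff_distrib[symmetric] vector_smult_assoc)
      then show "c *s x \<in> V" unfolding V by blast
    qed
    moreover have "V \<noteq> UNIV"
      using not_pseudoreflection_rank[OF invertible[OF A(1)] A(2) no_pseudoreflection[OF A(1)], of u]
      unfolding V by blast
    ultimately show "vec.subspace V \<and> V \<noteq> UNIV" by blast
  qed (use finite_G in simp)
  then obtain w where "\<And>A B. A \<in> G - {mat 1} \<Longrightarrow> B \<in> G - {mat 1} \<Longrightarrow> w \<notin> U (A, B)"
    by (metis SigmaI imageI)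
  with v show ?thesis unfolding U_def by (intro exI[of _ v] exI[of _ w]) auto
qed

text \<open>For a linear form the denominator splits into linear forms, so coprimality reduces to
  vectors not being proportional.\<close>

lemma disc_linform: "disc (linform v) = (\<Prod>A\<in>G-{mat 1}. linform (v - A *v v))"
proof -
  have "lin_act ` G - {id} = lin_act ` (G - {mat 1})" using lin_act_eq_id by auto
  then show ?thesis
    unfolding disc_def
    by (simp add: prod.reindex inj_on_def lin_act_inj lin_act_linform linform_diff)
qed

lemma exists_coprime_discs:
  "\<exists>s t. disc s \<noteq> 0 \<and> disc t \<noteq> 0 \<and> (\<forall>M N g. disc s ^ M dvd disc t ^ N * g \<longrightarrow> disc s ^ M dvd g)"
proof -
  obtain v w where v: "\<And>A. A \<in> G - {mat 1} \<Longrightarrow> A *v v \<noteq> v"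
    and w: "\<And>A B c. A \<in> G - {mat 1} \<Longrightarrow> B \<in> G - {mat 1} \<Longrightarrow> A *v w - w \<noteq> c *s (B *v v - v)"
    using exists_generic_pair by blast
  have prod_nz: "(\<Prod>x\<in>X. h x) \<noteq> 0" if "\<And>x. x \<in> X \<Longrightarrow> h x \<noteq> 0" for X and h :: "_ \<Rightarrow> ('k, 'n) mpoly"
    using that by (induction X rule: infinite_finite_induct) (auto dest: mpoly_nzd)
  have s: "disc (linform v) \<noteq> 0"
    unfolding disc_linform by (intro prod_nz) (metis linform_eq_0_iff v eq_iff_diff_eq_0)
  \<comment> \<open>The case c = 0, B = A of the choice of \<open>w\<close>: no A other than 1 fixes
    it.\<close>
  have t: "disc (linform w) \<noteq> 0"
    unfolding disc_linform
    by (intro prod_nz) (metis linform_eq_0_iff w vec.scale_zero_left eq_iff_diff_eq_0)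
  have "nzd_mod (linform (v - B *v v)) (linform (w - A *v w))"
    if "A \<in> G - {mat 1}" "B \<in> G - {mat 1}" for A B
  proof (rule nzd_mod_linform)
    show "v - B *v v \<noteq> 0" using v[OF that(2)] by auto
    \<comment> \<open>The sign differs from the choice of \<open>w\<close> on both sides, so it
      cancels with the same \<open>c\<close>.\<close>
    show "w - A *v w \<noteq> c *s (v - B *v v)" for c
      using w[OF that, of c] vec.scale_right_diff_distrib[of c v "B *v v"]
        vec.scale_right_diff_distrib[of c "B *v v" v] by (metis minus_diff_eq)
  qed
  then have "nzd_mod (disc (linform v)) (disc (linform w))"
    unfolding disc_linform
    by (intro nzd_mod_prod_left nzd_mod_prod_right conjI)
      (metis linform_eq_0_iff v eq_iff_diff_eq_0, blast)
  then have "nzd_mod (disc (linform v) ^ M) (disc (linform w) ^ N)" for M N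
    by (intro nzd_mod_power_left nzd_mod_power_right s)
  with s t show ?thesis unfolding nzd_mod_def by blast
qed

section \<open>Restriction to the invariants and extension from them\<close>

lemma D_ring_eqI:
  assumes "\<xi> \<in> D_ring" "\<eta> \<in> D_ring" "\<And>r. r \<in> R \<Longrightarrow> \<xi> r = \<eta> r"
  shows "\<xi> = \<eta>"
  using exists_coprime_discs assms diff_op_eqI unfolding carrier_diff_op_ring_UNIV by blast

lemma op_act_eq_conj_op: "op_act A \<xi> = conj_op A (inv\<^bsub>GL\<^esub> A) \<xi>"
  by (simp add: fun_eq_iff op_act_def conj_op_def)

lemma op_act_D_ring: "A \<in> G \<Longrightarrow> \<xi> \<in> D_ring \<Longrightarrow> op_act A \<xi> \<in> D_ring"
  unfolding op_act_eq_conj_op by (rule conj_op_D_ring[OF inv_mult(2)])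

lemma op_act_eq_iff:
  assumes "A \<in> G"
  shows "op_act A \<xi> = \<xi> \<longleftrightarrow> (\<forall>f. \<xi> (lin_act A f) = lin_act A (\<xi> f))"
proof -
  have "lin_act A (lin_act (inv\<^bsub>GL\<^esub> A) f) = f" "lin_act (inv\<^bsub>GL\<^esub> A) (lin_act A f) = f" for f
    using assms by (simp_all add: lin_act_compose inv_mult lin_act_mat_1)
  then show ?thesis unfolding op_act_def fun_eq_iff by metis
qed

lemma invariant_diff_ops_iff:
  "\<xi> \<in> invariant_diff_ops G \<longleftrightarrow>
    \<xi> \<in> D_ring \<and> (\<forall>A\<in>G. \<forall>f. \<xi> (lin_act A f) = lin_act A (\<xi> f))"
  unfolding invariant_diff_ops_def using op_act_eq_iff by blast

lemma invariant_maps_R: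
  "\<xi> \<in> invariant_diff_ops G \<Longrightarrow> r \<in> R \<Longrightarrow> \<xi> r \<in> R"
  by (auto simp: invariant_diff_ops_iff R_eq invariant_ring_def) metis

text \<open>The commutator of an equivariant operator with an invariant is equivariant again, and
  restricting it gives the commutator on R; so the induction carries equivariance along.\<close>

lemma restrict_diff_ops_le:
  assumes "\<xi> \<in> orderS (Suc n)" and "\<forall>A\<in>G. \<forall>f. \<xi> (lin_act A f) = lin_act A (\<xi> f)"
  shows "restrict \<xi> R \<in> diff_ops_le mconst R n"
  using assms
proof (induction n arbitrary: \<xi>)
  case 0
  have eq: "\<xi> f = \<xi> 1 * f" for f
  proof -
    have "ad \<xi> f = (\<lambda>_. 0)" using "0.prems"(1) by simp
    from fun_cong[OF this, of 1] show ?thesis by (simp add: ad_apply mult.commute)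
  qed
  have "restrict \<xi> R = mult_op R (\<xi> 1)" unfolding mult_op_def by (intro restrict_ext eq)
  moreover have "\<xi> 1 \<in> R"
    using "0.prems"(2) by (simp add: R_eq invariant_ring_def) (metis lin_act_1)
  ultimately show ?case by simp
next
  case (Suc n)
  note \<xi> = ord_less_alg_End[OF Suc.prems(1)]
  have "\<xi> r \<in> R" if "r \<in> R" for r
    using Suc.prems(2) that by (auto simp: R_eq invariant_ring_def) metis
  then have "restrict \<xi> R \<in> alg_End mconst R"
    by (auto simp: alg_End_def R_add R_mult scalar_mem alg_End_UNIV_add[OF \<xi>] alg_End_UNIV_scale[OF \<xi>])
  moreover have "op_commutator R (restrict \<xi> R) f \<in> diff_ops_le mconst R n" if "f \<in> R" for f
  proof -
    have "op_commutator R (restrict \<xi> R) f = restrict (ad \<xi> f) R"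
      using that by (auto simp: op_commutator_def R_mult)
    moreover have "restrict (ad \<xi> f) R \<in> diff_ops_le mconst R n"
    proof (rule Suc.IH)
      show "ad \<xi> f \<in> orderS (Suc n)" using Suc.prems(1) by (rule ord_less_SucD) simp
      show "\<forall>A\<in>G. \<forall>g. ad \<xi> f (lin_act A g) = lin_act A (ad \<xi> f g)"
      proof (intro ballI allI)
        fix A g assume A: "A \<in> G"
        then have f: "lin_act A f = f" using that by (simp add: R_eq invariant_ring_def)
        have equivariant: "lin_act A (\<xi> h) = \<xi> (lin_act A h)" for h
          using Suc.prems(2) A by simp
        have "lin_act A (x - y) = lin_act A x - lin_act A y" for x y
          using lin_act_add[of A "x - y" y] by simp
        then show "ad \<xi> f (lin_act A g) = lin_act A (ad \<xi> f g)"
          by (simp add: ad_apply equivariant lin_act_mult f)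
      qed
    qed
    ultimately show ?thesis by simp
  qed
  ultimately show ?case unfolding diff_ops_le.simps by blast
qed

lemma diff_ops_le_alg_End: "\<delta> \<in> diff_ops_le mconst R n \<Longrightarrow> \<delta> \<in> alg_End mconst R"
proof (cases n)
  case 0
  assume "\<delta> \<in> diff_ops_le mconst R n"
  then show ?thesis
    using 0 by (auto simp: alg_End_def mult_op_def R_add R_mult scalar_mem distrib_left
        mult.left_commute)
qed simp

text \<open>On R the trace is multiplication by the group order, so the extension of \<delta>
  \<circ> tr divided by it extends \<delta>. Its invariance follows from uniqueness of
  extensions.\<close>

lemma kantor_surj:
  assumes "\<delta> \<in> diff_ops_le mconst R n"
  shows "\<exists>\<xi>\<in>invariant_diff_ops G. restrict \<xi> R = \<delta>"
proof -
  have \<delta>: "\<delta> \<in> alg_End mconst R" by (rule diff_ops_le_alg_End[OF assms])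
  obtain \<eta> where \<eta>: "\<eta> \<in> orderS (Suc n)" "\<And>r. r \<in> R \<Longrightarrow> \<eta> r = \<delta> (tr r)"
    using exists_coprime_discs extend[OF _ _ _ tr_ord_less[OF assms]] by (metis comp_apply)
  \<comment> \<open>The number of summands of \<open>tr\<close>, as a scalar; characteristic zero
    makes it invertible.\<close>
  define N where "N = (of_nat (card (lin_act ` G)) :: 'k)"
  have "N \<noteq> 0"
    using finite_G mat_1_mem by (auto simp: N_def card_eq_0_iff)
  define \<xi> where "\<xi> = (\<lambda>f. mconst (inverse N) * \<eta> f)"
  have "\<xi> \<in> D_ring" unfolding \<xi>_def by (rule D_ring_lmult[OF ord_less_D_ring[OF \<eta>(1)]])
  have N: "of_nat (card (lin_act ` G)) = mconst N"
    by (simp add: N_def mconst_def)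
  have \<xi>_R: "\<xi> r = \<delta> r" if "r \<in> R" for r
  proof -
    have "\<eta> r = \<delta> (mconst N * r)" using \<eta>(2)[OF that] tr_of_R[OF that] by (simp only: N)
    also have "\<dots> = mconst N * \<delta> r" using \<delta> that by (simp add: alg_End_def)
    finally have "\<xi> r = mconst (inverse N * N) * \<delta> r"
      by (simp only: \<xi>_def mconst_mult mult.assoc)
    then show ?thesis using \<open>N \<noteq> 0\<close> by simp
  qed
  \<comment> \<open>Both are differential operators on S, and on R both are \<delta>, since \<delta>
    maps invariants to invariants.\<close>
  have "op_act A \<xi> = \<xi>" if "A \<in> G" for A
  proof (rule D_ring_eqI[OF op_act_D_ring[OF that \<open>\<xi> \<in> D_ring\<close>] \<open>\<xi> \<in> D_ring\<close>])
    fix r assume r: "r \<in> R"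
    then have "lin_act (inv\<^bsub>GL\<^esub> A) r = r"
      using inv_mem[OF that] by (simp add: R_eq invariant_ring_def)
    moreover have "\<delta> r \<in> R" using \<delta> r by (auto simp: alg_End_def)
    ultimately show "op_act A \<xi> r = \<xi> r"
      using r that by (simp add: op_act_def \<xi>_R R_eq invariant_ring_def)
  qed
  then have "\<xi> \<in> invariant_diff_ops G"
    using \<open>\<xi> \<in> D_ring\<close> by (simp add: invariant_diff_ops_def)
  moreover have "restrict \<xi> R = \<delta>"
    using \<delta> \<xi>_R by (auto simp: alg_End_def fun_eq_iff PiE_def extensional_def)
  ultimately show ?thesis by blast
qed

abbreviation D_R :: "(('k, 'n) mpoly \<Rightarrow> ('k, 'n) mpoly) ring" where
  "D_R \<equiv> diff_op_ring mconst (invariant_ring G)"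

lemma kantor: "bij_betw (restrict_op G) (invariant_diff_ops G) (carrier D_R)"
  unfolding bij_betw_def
proof
  show "inj_on (restrict_op G) (invariant_diff_ops G)"
  proof (rule inj_onI)
    fix \<xi> \<eta> assume \<xi>: "\<xi> \<in> invariant_diff_ops G" and \<eta>: "\<eta> \<in> invariant_diff_ops G"
      and eq: "restrict_op G \<xi> = restrict_op G \<eta>"
    show "\<xi> = \<eta>"
    proof (rule D_ring_eqI)
      show "\<xi> r = \<eta> r" if "r \<in> R" for r
        using fun_cong[OF eq, of r] that by (simp add: restrict_op_def R_eq)
    qed (use \<xi> \<eta> in \<open>simp_all add: invariant_diff_ops_iff\<close>)
  qed
  have carrier: "carrier D_R = (\<Union>n. diff_ops_le mconst R n)" by (simp add: diff_op_ring_def R_eq)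
  show "restrict_op G ` invariant_diff_ops G = carrier D_R"
  proof (intro equalityI subsetI)
    fix \<delta> assume "\<delta> \<in> restrict_op G ` invariant_diff_ops G"
    then obtain \<xi> n where "\<delta> = restrict \<xi> R" "\<xi> \<in> orderS n"
      "\<forall>A\<in>G. \<forall>f. \<xi> (lin_act A f) = lin_act A (\<xi> f)"
      by (auto simp: invariant_diff_ops_iff restrict_op_def R_eq carrier_diff_op_ring_UNIV)
    then show "\<delta> \<in> carrier D_R"
      unfolding carrier using restrict_diff_ops_le[OF ord_less_Suc] by (blast intro: UN_I)
  next
    fix \<delta> assume "\<delta> \<in> carrier D_R"
    then show "\<delta> \<in> restrict_op G ` invariant_diff_ops G"
      unfolding carrier using kantor_surj by (force simp: restrict_op_def R_eq)
  qed
qed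

section \<open>The transposition on invariant operators and on R\<close>

lemma transposition_invariant:
  assumes "\<xi> \<in> invariant_diff_ops G"
  shows "transposition \<xi> \<in> invariant_diff_ops G"
proof -
  have \<xi>: "\<xi> \<in> D_ring" using assms by (simp add: invariant_diff_ops_def)
  have "op_act A (transposition \<xi>) = transposition (op_act A \<xi>)" if "A \<in> G" for A
    unfolding op_act_eq_conj_op using transposition_conj_op[OF _ _ \<xi>] inv_mult[OF that] by metis
  then show ?thesis
    using assms by (simp add: invariant_diff_ops_def transposition_D_ring)
qed

text \<open>By \<open>kantor\<close> every operator on R is such a restriction, so each claim about
  the induced map becomes one about \<open>transposition\<close> on S.\<close>

lemma induced_transposition_restrict:
  assumes "\<xi> \<in> invariant_diff_ops G"
  shows "induced_transposition G (restrict_op G \<xi>) = restrict_op G (transposition \<xi>)"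
  using the_inv_into_f_f[OF bij_betw_imp_inj_on[OF kantor] assms]
  by (simp add: induced_transposition_def standard_transposition_eq)

lemma invariant_add:
  "\<xi> \<in> invariant_diff_ops G \<Longrightarrow> \<eta> \<in> invariant_diff_ops G \<Longrightarrow>
    (\<lambda>f. \<xi> f + \<eta> f) \<in> invariant_diff_ops G"
  by (simp add: invariant_diff_ops_iff D_ring_add lin_act_add)

lemma invariant_comp:
  "\<xi> \<in> invariant_diff_ops G \<Longrightarrow> \<eta> \<in> invariant_diff_ops G \<Longrightarrow>
    (\<lambda>f. \<xi> (\<eta> f)) \<in> invariant_diff_ops G"
  using D_ring_comp[of \<xi> \<eta>] by (simp add: invariant_diff_ops_iff comp_def)

lemma invariant_mult: "a \<in> R \<Longrightarrow> (\<lambda>f. a * f) \<in> invariant_diff_ops G"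
  by (simp add: invariant_diff_ops_iff mult_D_ring lin_act_mult R_eq invariant_ring_def)

lemma restrict_add:
  "restrict_op G \<xi> \<oplus>\<^bsub>D_R\<^esub> restrict_op G \<eta> = restrict_op G (\<lambda>f. \<xi> f + \<eta> f)"
  by (auto simp: diff_op_ring_def restrict_op_def)

lemma restrict_mult:
  "\<eta> \<in> invariant_diff_ops G \<Longrightarrow>
    restrict_op G \<xi> \<otimes>\<^bsub>D_R\<^esub> restrict_op G \<eta> = restrict_op G (\<lambda>f. \<xi> (\<eta> f))"
  using invariant_maps_R[unfolded R_eq] by (auto simp: diff_op_ring_def restrict_op_def compose_def)

lemma restrict_one: "\<one>\<^bsub>D_R\<^esub> = restrict_op G (\<lambda>f. f)"
  by (simp add: diff_op_ring_def restrict_op_def)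

lemma carrier_D_R: "\<delta> \<in> carrier D_R \<longleftrightarrow> (\<exists>\<xi>\<in>invariant_diff_ops G. \<delta> = restrict_op G \<xi>)"
  using bij_betw_imp_surj_on[OF kantor] by blast

lemma invariant_D_ring: "\<xi> \<in> invariant_diff_ops G \<Longrightarrow> \<xi> \<in> D_ring"
  by (simp add: invariant_diff_ops_iff)

lemma induced_transposition_involutive:
  "\<delta> \<in> carrier D_R \<Longrightarrow> induced_transposition G \<delta> \<in> carrier D_R \<and>
    induced_transposition G (induced_transposition G \<delta>) = \<delta>"
  unfolding carrier_D_R
  by (auto simp: induced_transposition_restrict transposition_invariant transposition_involutive
      invariant_D_ring)

lemma induced_transposition_anti_automorphism:
  "ring_anti_automorphism D_R (induced_transposition G)"
  unfolding ring_anti_automorphism_def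
proof (intro conjI ballI)
  show "bij_betw (induced_transposition G) (carrier D_R) (carrier D_R)"
    using induced_transposition_involutive
    by (intro bij_betwI[where g = "induced_transposition G"]) auto
  have id: "(\<lambda>f. f) \<in> invariant_diff_ops G" by (simp add: invariant_diff_ops_iff id_D_ring)
  show "induced_transposition G \<one>\<^bsub>D_R\<^esub> = \<one>\<^bsub>D_R\<^esub>"
    unfolding restrict_one induced_transposition_restrict[OF id] transposition_id ..
next
  fix x y assume "x \<in> carrier D_R" "y \<in> carrier D_R"
  then obtain \<xi> \<eta> where inv: "\<xi> \<in> invariant_diff_ops G" "\<eta> \<in> invariant_diff_ops G"
    and xy: "x = restrict_op G \<xi>" "y = restrict_op G \<eta>" unfolding carrier_D_R by blast
  note D = inv[THEN invariant_D_ring] and T = inv[THEN transposition_invariant]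
  show "induced_transposition G (x \<oplus>\<^bsub>D_R\<^esub> y) =
      induced_transposition G x \<oplus>\<^bsub>D_R\<^esub> induced_transposition G y"
    unfolding xy restrict_add induced_transposition_restrict[OF invariant_add[OF inv]]
      inv[THEN induced_transposition_restrict] transposition_add[OF D] ..
  show "induced_transposition G (x \<otimes>\<^bsub>D_R\<^esub> y) =
      induced_transposition G y \<otimes>\<^bsub>D_R\<^esub> induced_transposition G x"
    unfolding xy restrict_mult[OF inv(2)] induced_transposition_restrict[OF invariant_comp[OF inv]]
      inv[THEN induced_transposition_restrict] transposition_comp[OF D] restrict_mult[OF T(1)] ..
qed

lemma transposition_image_invariant:
  "transposition ` invariant_diff_ops G = invariant_diff_ops G"
proof
  show "invariant_diff_ops G \<subseteq> transposition ` invariant_diff_ops G"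
    using transposition_involutive[OF invariant_D_ring] transposition_invariant by (metis image_eqI subsetI)
qed (use transposition_invariant in blast)

lemma induced_transposition_mult_op:
  assumes "a \<in> invariant_ring G"
  shows "induced_transposition G (mult_op (invariant_ring G) a) = mult_op (invariant_ring G) a"
proof -
  have "mult_op (invariant_ring G) a = restrict_op G (\<lambda>f. a * f)"
    by (simp add: mult_op_def restrict_op_def)
  then show ?thesis
    using induced_transposition_restrict[OF invariant_mult] assms
    by (simp add: R_eq transposition_mult)
qed

end

theorem theorem5p4:
  fixes G :: "('k::field_char_0 ^ 'n ^ 'n::finite) set"
  assumes "subgroup G GL" and "finite G"
    and "\<forall>\<gamma>\<in>G. \<not> pseudoreflection \<gamma>"
  defines "R \<equiv> invariant_ring G"
  shows "standard_transposition ` invariant_diff_ops G = invariant_diff_ops G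
    \<and> ring_anti_automorphism (diff_op_ring mconst R) (induced_transposition G)
    \<and> involutive_on (carrier (diff_op_ring mconst R)) (induced_transposition G)
    \<and> (\<forall>f\<in>R. induced_transposition G (mult_op R f) = mult_op R f)"
proof -
  interpret reflection_free G by (rule reflection_free.intro) (use assms in auto)
  show ?thesis
    unfolding assms(4) standard_transposition_eq involutive_on_def
    using transposition_image_invariant induced_transposition_anti_automorphism
      induced_transposition_involutive induced_transposition_mult_op
    by blast
qed

end
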